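(* Let $p>2$. Assume that the metric graph $G$ is a half-line $e_0$ plus a finite number of bounded or unbounded edges attached to $e_0$ at a unique inner vertex $P$ (the finite vertex of $e_0$). Then there is no solution to the minimization problem $$\frac1{C_p(G)}=\inf_{v\in H^1_0(G)\setminus\{0\}}\frac{\int_G(|v'|^2+|v|^2)\,dx}{\left(\int_G|v|^p\,dx\right)^{2/p}}$$ (that is, the infimum is not attained), and $C_p(G)=C_p(\mathbb{R})$.
   Context: A (planar, metric) graph $G$ consists of vertices and of edges, each edge being either a bounded edge joining two vertices (of length equal to the distance between its endpoints) or an unbounded edge, i.e. a half-line issued from one vertex (of infinite length). A vertex is outer if it belongs to only one edge, and inner otherwise. Integrals over $G$ are sums over the edges of integrals with respect to arc length. $H^1(G)$ is the set of continuous functions $f$ on $G$ belonging to $H^1(e)$ for each edge $e$ with $\sum_e\|f\|_{H^1(e)}^2<\infty$; $H^1_0(G)$ is the subspace of functions vanishing at all outer vertices (Dirichlet condition). $C_p(G)$ is the best constant in the inequality $\left(\int_G|v|^p\,dx\right)^{2/p}\le C_p(G)\int_G(|v'|^2+|v|^2)\,dx$ for all $v\in H^1_0(G)$; $C_p(\mathbb{R})$ is the same constant for the real line, with $H^1_0(\mathbb{R})=H^1(\mathbb{R})$.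
   Formalization: The case where the only edge attached to e_0 is a single further half-line is excluded: then G is isometric to the real line, where the infimum is attained, so the claim of no solution fails there. *)

theory Defs
  imports "HOL-Analysis.Analysis"
begin

definition L2_on :: "real set \<Rightarrow> (real \<Rightarrow> real) set" where
  "L2_on I = {f. set_borel_measurable lborel I f \<and> set_integrable lborel I (\<lambda>x. (f x)\<^sup>2)}"

text \<open>Test functions are \<open>C\<^sup>1\<close> with compact support in \<open>I\<close>; on an open interval they determine
  the same weak derivatives as smooth ones.\<close>

definition test_functions :: "real set \<Rightarrow> (real \<Rightarrow> real) set" where
  "test_functions I =
     {\<phi>. \<phi> C1_differentiable_on UNIV \<and> (\<exists>K. compact K \<and> K \<subseteq> I \<and> (\<forall>x. x \<notin> K \<longrightarrow> \<phi> x = 0))}"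

definition has_weak_deriv :: "real set \<Rightarrow> (real \<Rightarrow> real) \<Rightarrow> (real \<Rightarrow> real) \<Rightarrow> bool" where
  "has_weak_deriv I f g \<longleftrightarrow>
     (\<forall>\<phi>\<in>test_functions I.
        (LINT x:I|lborel. f x * deriv \<phi> x) = - (LINT x:I|lborel. g x * \<phi> x))"

definition H1_on :: "real set \<Rightarrow> (real \<Rightarrow> real) set" where
  "H1_on I = {f \<in> L2_on I. \<exists>g\<in>L2_on I. has_weak_deriv I f g}"

text \<open>The weak derivative is only unique almost everywhere; it is only used under integrals.\<close>

definition weak_deriv :: "real set \<Rightarrow> (real \<Rightarrow> real) \<Rightarrow> real \<Rightarrow> real" where
  "weak_deriv I f = (SOME g. g \<in> L2_on I \<and> has_weak_deriv I f g)"

definition H1_energy :: "real set \<Rightarrow> (real \<Rightarrow> real) \<Rightarrow> real" where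
  "H1_energy I f = (LINT x:I|lborel. (weak_deriv I f x)\<^sup>2 + (f x)\<^sup>2)"

type_synonym plane = "real ^ 2"

text \<open>\<open>Bounded a b\<close> is the segment from \<open>a\<close> to \<open>b\<close>; \<open>Unbounded a u\<close> is the half-line issued
  from \<open>a\<close> in the direction of the unit vector \<open>u\<close>.\<close>

datatype edge = Bounded plane plane | Unbounded plane plane

fun edge_ends :: "edge \<Rightarrow> plane set" where
  "edge_ends (Bounded a b) = {a, b}"
| "edge_ends (Unbounded a u) = {a}"

fun edge_set :: "edge \<Rightarrow> plane set" where
  "edge_set (Bounded a b) = closed_segment a b"
| "edge_set (Unbounded a u) = {a + t *\<^sub>R u |t. 0 \<le> t}"

fun edge_ok :: "edge \<Rightarrow> bool" where
  "edge_ok (Bounded a b) \<longleftrightarrow> a \<noteq> b"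
| "edge_ok (Unbounded a u) \<longleftrightarrow> norm u = 1"

text \<open>Arc-length parametrization of an edge, on the open interval \<open>edge_dom e\<close>.\<close>

fun edge_dom :: "edge \<Rightarrow> real set" where
  "edge_dom (Bounded a b) = {0<..<dist a b}"
| "edge_dom (Unbounded a u) = {0<..}"

fun edge_param :: "edge \<Rightarrow> real \<Rightarrow> plane" where
  "edge_param (Bounded a b) t = a + t *\<^sub>R sgn (b - a)"
| "edge_param (Unbounded a u) t = a + t *\<^sub>R u"

record graph =
  verts :: "plane set"
  edges :: "edge set"

definition graph_points :: "graph \<Rightarrow> plane set" where
  "graph_points G = verts G \<union> (\<Union>e\<in>edges G. edge_set e)"

text \<open>The last condition also excludes two edges \<open>Bounded a b\<close>, \<open>Bounded b a\<close> on the same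
  segment.\<close>

definition metric_graph :: "graph \<Rightarrow> bool" where
  "metric_graph G \<longleftrightarrow>
     (\<forall>e\<in>edges G. edge_ok e \<and> edge_ends e \<subseteq> verts G \<and> edge_set e \<inter> verts G \<subseteq> edge_ends e) \<and>
     (\<forall>e\<in>edges G. \<forall>e'\<in>edges G. e \<noteq> e' \<longrightarrow>
        edge_set e \<inter> edge_set e' \<subseteq> edge_ends e \<inter> edge_ends e')"

definition outer_verts :: "graph \<Rightarrow> plane set" where
  "outer_verts G = {v \<in> verts G. \<exists>!e. e \<in> edges G \<and> v \<in> edge_ends e}"

definition inner_verts :: "graph \<Rightarrow> plane set" where
  "inner_verts G = verts G - outer_verts G"

text \<open>Functions on a graph are represented by functions on the plane, whose values outside
  \<open>graph_points G\<close> are irrelevant.\<close>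

definition H1_graph :: "graph \<Rightarrow> (plane \<Rightarrow> real) set" where
  "H1_graph G =
     {f. continuous_on (graph_points G) f \<and>
         (\<forall>e\<in>edges G. f \<circ> edge_param e \<in> H1_on (edge_dom e)) \<and>
         (\<lambda>e. H1_energy (edge_dom e) (f \<circ> edge_param e)) summable_on edges G}"

definition H10_graph :: "graph \<Rightarrow> (plane \<Rightarrow> real) set" where
  "H10_graph G = {f \<in> H1_graph G. \<forall>v\<in>outer_verts G. f v = 0}"

definition graph_energy :: "graph \<Rightarrow> (plane \<Rightarrow> real) \<Rightarrow> real" where
  "graph_energy G f = (\<Sum>\<^sub>\<infinity>e\<in>edges G. H1_energy (edge_dom e) (f \<circ> edge_param e))"

definition graph_Lp :: "graph \<Rightarrow> real \<Rightarrow> (plane \<Rightarrow> real) \<Rightarrow> real" where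
  "graph_Lp G p f =
     (\<Sum>\<^sub>\<infinity>e\<in>edges G. LINT t:edge_dom e|lborel. \<bar>f (edge_param e t)\<bar> powr p)"

definition nonzero_H10 :: "graph \<Rightarrow> (plane \<Rightarrow> real) set" where
  "nonzero_H10 G = {f \<in> H10_graph G. \<exists>x\<in>graph_points G. f x \<noteq> 0}"

definition gns_quotient :: "graph \<Rightarrow> real \<Rightarrow> (plane \<Rightarrow> real) \<Rightarrow> real" where
  "gns_quotient G p f = graph_energy G f / graph_Lp G p f powr (2 / p)"

definition best_const :: "graph \<Rightarrow> real \<Rightarrow> real" where
  "best_const G p =
     Inf {C. \<forall>f\<in>H10_graph G. graph_Lp G p f powr (2 / p) \<le> C * graph_energy G f}"

text \<open>The same constant for the real line; functions in \<open>H\<^sup>1\<close> are represented by their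
  continuous representatives, as on graphs.\<close>

definition best_const_line :: "real \<Rightarrow> real" where
  "best_const_line p =
     Inf {C. \<forall>f\<in>H1_on UNIV. continuous_on UNIV f \<longrightarrow>
            (LINT x|lborel. \<bar>f x\<bar> powr p) powr (2 / p) \<le> C * H1_energy UNIV f}"

end

theory Submission
  imports Defs "HOL-Real_Asymp.Real_Asymp"
begin

text \<open>No rearrangement is needed. For \<open>\<bar>f\<bar> \<le> 1\<close> put \<open>s(f) = sqrt (f\<^sup>2 - \<bar>f\<bar>\<^sup>p)\<close> and let \<open>F\<close> be the
  primitive of \<open>2 s\<close> vanishing at \<open>0\<close>. Completing the square,
  \<open>f'\<^sup>2 + f\<^sup>2 - \<bar>f\<bar>\<^sup>p = (\<bar>f'\<bar> - s(f))\<^sup>2 + 2 s(f) \<bar>f'\<bar>\<close>, and the integral of the last term dominates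
  the variation of \<open>F \<circ> f\<close>. After scaling to \<open>max \<bar>f\<bar> = 1\<close>, two disjoint paths lead from the
  maximum to zeros of \<open>f\<close> (outer vertices or infinity), so the energy is at least
  \<open>2 F(1) + \<integral> \<bar>f\<bar>\<^sup>p\<close>, and Young's inequality gives the sharp bound. On the line it is an equality for the
  soliton \<open>cosh (\<alpha> x) powr (- 1 / \<alpha>)\<close>, \<open>\<alpha> = (p - 2) / 2\<close>; truncations of it, translated into a
  half-line, show that the constant is optimal on the line and on the graph alike.

  If equality held on the graph, then \<open>\<bar>f'\<bar> = s(f) \<le> \<bar>f\<bar>\<close> almost everywhere, so on every edge \<open>f\<close>
  vanishes identically as soon as it vanishes at an end. A bounded edge therefore forces
  \<open>f(P) = 0\<close>, and so does a third edge, whose variation \<open>F(\<bar>f(P)\<bar>)\<close> would be a surplus. In both cases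
  \<open>f = 0\<close>.\<close>


section \<open>Weak derivatives and absolute continuity\<close>

text \<open>The two paths come from bookkeeping over the n edges, with c the value at P. On the edge
  where |f| is nearly 1, the variation of F o f is about F(1) towards the far end and at least F(1)
  - F(|c|) towards P, and each other edge adds at least F(|c|). The total 2 F(1) + (n - 2) F(|c|) is
  at least 2 F(1) once n >= 2. A single edge with c = 0 also fits this formula, so the line is
  treated as a network with one edge.

  F(1) is never evaluated. Minimising (2 F(1) + J) / J^(2/p) over J > 0 gives J = 4 F(1) / (p - 2),
  and two integrations show that this is the p-th power integral of the soliton.

  The scaling must use the supremum exactly: the square root needs |f| <= 1, while F(1) needs values
  close to 1. The supremum may be attained only at P or not be known to be attained on an open edge,
  so values above 1 - eta are used and continuity of F finishes.

  Two half-lines have to be excluded because they form a copy of the line, on which the soliton is a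
  minimiser.\<close>

definition ramp :: "real \<Rightarrow> real" where
  "ramp t = max 0 t"

lemma DERIV_ramp_square: "((\<lambda>t. (ramp t)\<^sup>2) has_real_derivative 2 * ramp t) (at t)"
proof -
  consider "t < 0" | "t > 0" | "t = 0" by linarith
  then show ?thesis
  proof cases
    case 1
    have ev: "\<forall>\<^sub>F x in nhds t. x < 0"
      using 1 by (simp add: eventually_nhds_in_open[of "{..<0}", simplified])
    have "((\<lambda>t. (ramp t)\<^sup>2) has_real_derivative 2 * ramp t) (at t) \<longleftrightarrow>
        ((\<lambda>t. 0::real) has_real_derivative 0) (at t)"
      by (rule DERIV_cong_ev) (use 1 in \<open>auto simp: ramp_def intro: eventually_mono[OF ev]\<close>)
    then show ?thesis by simp
  next
    case 2
    have ev: "\<forall>\<^sub>F x in nhds t. x > 0"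
      using 2 by (simp add: eventually_nhds_in_open[of "{0<..}", simplified])
    have "((\<lambda>t. (ramp t)\<^sup>2) has_real_derivative 2 * ramp t) (at t) \<longleftrightarrow>
        ((\<lambda>t. t\<^sup>2) has_real_derivative 2 * t) (at t)"
      by (rule DERIV_cong_ev) (use 2 in \<open>auto simp: ramp_def intro: eventually_mono[OF ev]\<close>)
    then show ?thesis by (auto intro!: derivative_eq_intros)
  next
    case 3
    have "((\<lambda>y. ((ramp y)\<^sup>2 - (ramp 0)\<^sup>2) / (y - 0)) \<longlongrightarrow> 0) (at 0)"
    proof (rule Lim_null_comparison)
      show "\<forall>\<^sub>F y in at (0::real). norm (((ramp y)\<^sup>2 - (ramp 0)\<^sup>2) / (y - 0)) \<le> \<bar>y\<bar>"
        by (auto simp: ramp_def max_def power2_eq_square)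
      show "((\<lambda>y::real. \<bar>y\<bar>) \<longlongrightarrow> 0) (at 0)"
        by (rule tendsto_eq_intros refl | simp)+
    qed
    then show ?thesis
      using 3 by (simp add: has_field_derivative_iff ramp_def)
  qed
qed

text \<open>A C^1 step from 0 to 1 over [0, 2] whose derivative is the piecewise linear
  \<open>tent\<close>. Since test functions are only required to be C^1, differences of such steps
  can replace smooth mollifiers.\<close>

definition spline :: "real \<Rightarrow> real" where
  "spline t = ((ramp t)\<^sup>2 - 2 * (ramp (t - 1))\<^sup>2 + (ramp (t - 2))\<^sup>2) / 2"

definition tent :: "real \<Rightarrow> real" where
  "tent t = ramp t - 2 * ramp (t - 1) + ramp (t - 2)"

lemma DERIV_spline: "(spline has_real_derivative tent t) (at t)"
proof -
  have s: "((\<lambda>t. (ramp (t - c))\<^sup>2) has_real_derivative 2 * ramp (t - c)) (at t)" for c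
    by (rule DERIV_chain2[OF DERIV_ramp_square, THEN DERIV_cong] derivative_eq_intros refl | simp)+
  show ?thesis
    unfolding spline_def[abs_def] tent_def
    by (rule DERIV_cong[OF DERIV_cdivide[OF DERIV_add[OF DERIV_diff[OF DERIV_ramp_square
            DERIV_cmult[OF s]] s]]]) simp
qed

lemma continuous_tent: "continuous_on A tent"
  unfolding tent_def[abs_def] ramp_def by (intro continuous_intros)

lemma tent_bounds: "0 \<le> tent t" "tent t \<le> 1" and tent_outside: "t \<notin> {0..2} \<Longrightarrow> tent t = 0"
  by (auto simp: tent_def ramp_def max_def)

lemma spline_left: "t \<le> 0 \<Longrightarrow> spline t = 0"
  by (auto simp: spline_def ramp_def)

lemma spline_right: "t \<ge> 2 \<Longrightarrow> spline t = 1"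
  by (auto simp: spline_def ramp_def power2_eq_square algebra_simps)

lemma spline_bounds: "0 \<le> spline t" "spline t \<le> 1"
proof -
  have mono: "spline x \<le> spline y" if "x \<le> y" for x y
    using DERIV_nonneg_imp_nondecreasing[OF that] DERIV_spline tent_bounds(1) by blast
  show "0 \<le> spline t" using mono[of "min t 0" t] by (auto simp: spline_left)
  show "spline t \<le> 1" using mono[of t "max t 2"] by (auto simp: spline_right)
qed

lemma integral_tent: "(\<integral>x. tent x \<partial>lborel) = 1"
proof -
  have c: "isCont tent x" for x
    using continuous_tent[of UNIV] by (simp add: continuous_on_eq_continuous_at)
  have eq: "tent x = tent x * indicator {0..2} x" for x
    using tent_outside[of x] by (auto simp: indicator_def)
  have "has_bochner_integral lborel (\<lambda>x. tent x * indicator {0..2} x) (spline 2 - spline 0)"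
    by (rule has_bochner_integral_FTC_Icc_real) (use DERIV_spline c in auto)
  then have "has_bochner_integral lborel tent 1"
    using eq by (simp add: spline_left spline_right)
  then show ?thesis
    by (simp add: has_bochner_integral_iff)
qed

lemma deriv_spline_bump:
  "((\<lambda>x. spline (n * (x - a)) - spline (n * (x - b))) has_real_derivative
      n * tent (n * (x - a)) - n * tent (n * (x - b))) (at x)"
  by (rule derivative_eq_intros DERIV_chain2[OF DERIV_spline] refl | simp)+

text \<open>For large \<open>n\<close> this is nearly the indicator of the interval from
  \<open>a\<close> to \<open>b\<close>, and its derivative is a difference of two concentrated unit
  masses. Both transitions lie to the right of their base point, so room of size
  \<open>2 / n\<close> is asked for beyond \<open>b\<close>.\<close>

lemma spline_bump_test_function:
  assumes n: "n > 0" and ab: "a < b" "b + 2 / n \<le> b'" and I: "{a..b'} \<subseteq> I"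
  shows "(\<lambda>x. spline (n * (x - a)) - spline (n * (x - b))) \<in> test_functions I"
proof -
  have "(\<lambda>x. spline (n * (x - a)) - spline (n * (x - b))) C1_differentiable_on UNIV"
    unfolding C1_differentiable_on_def
    by (rule exI[of _ "\<lambda>x. n * tent (n * (x - a)) - n * tent (n * (x - b))"], safe)
      (use deriv_spline_bump in \<open>auto simp: has_real_derivative_iff_has_vector_derivative
          intro!: continuous_intros continuous_on_compose2[OF continuous_tent[of UNIV]]\<close>)
  moreover have "spline (n * (x - a)) - spline (n * (x - b)) = 0" if "x \<notin> {a..b'}" for x
  proof (cases "x < a")
    case True
    then have "n * (x - a) \<le> 0" "n * (x - b) \<le> 0"
      using n ab by (auto simp: mult_le_0_iff)
    then show ?thesis by (simp add: spline_left)
  next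
    case False
    then have "x \<ge> b + 2 / n" using that ab by auto
    then have *: "2 / n \<le> x - b" by linarith
    then have "2 \<le> n * (x - b)" using n by (simp add: field_simps)
    moreover have "n * (x - b) \<le> n * (x - a)" using n ab by simp
    ultimately show ?thesis by (simp add: spline_right)
  qed
  ultimately show ?thesis
    unfolding test_functions_def using I by (intro CollectI conjI exI[of _ "{a..b'}"]) auto
qed

section \<open>The fundamental theorem of calculus for weak derivatives\<close>

lemma L2_on_set_integrable:
  assumes "f \<in> L2_on I" "{a..b} \<subseteq> I"
  shows "set_integrable lborel {a..b} f"
proof -
  have m: "set_borel_measurable lborel I f" and i: "set_integrable lborel I (\<lambda>x. (f x)\<^sup>2)"
    using assms(1) by (auto simp: L2_on_def)
  have eq: "indicator {a..b} x *\<^sub>R f x = indicator {a..b} x * (indicator I x *\<^sub>R f x)" for x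
    using assms(2) by (auto simp: indicator_def)
  have m': "(\<lambda>x. indicator {a..b} x *\<^sub>R f x) \<in> borel_measurable lborel"
    using m unfolding eq set_borel_measurable_def by measurable
  have "set_integrable lborel {a..b} (\<lambda>x. 1 + (f x)\<^sup>2)"
    by (intro set_integral_add set_integrable_subset[OF i _ assms(2)])
      (auto simp: set_integrable_def emeasure_lborel_Icc_eq)
  then show ?thesis
    unfolding set_integrable_def
  proof (rule Bochner_Integration.integrable_bound[OF _ m'], intro AE_I2)
    fix x
    have "\<bar>f x\<bar> \<le> 1 + (f x)\<^sup>2"
      using sum_squares_bound[of "\<bar>f x\<bar>" 1] by (simp add: power2_eq_square)
    then show "norm (indicator {a..b} x *\<^sub>R f x) \<le> norm (indicator {a..b} x *\<^sub>R (1 + (f x)\<^sup>2))"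
      by (auto simp: indicator_def)
  qed
qed

text \<open>The rescaled tents form a one-sided approximate identity at \<open>c\<close>. The
  substitution x = c + y / n moves \<open>n\<close> into the argument of \<open>f\<close>, and
  dominated convergence against the fixed \<open>tent\<close> gives the limit. Integrability is
  recorded because two such averages are subtracted later.\<close>

lemma tendsto_spline_average:
  fixes f :: "real \<Rightarrow> real"
  assumes I: "open I" "{c..b'} \<subseteq> I" and c: "c < b'" and f: "continuous_on I f"
    and m: "set_borel_measurable lborel I f"
  shows "(\<lambda>n. \<integral>x. indicator I x * f x * (real n * tent (real n * (x - c))) \<partial>lborel) \<longlonglongrightarrow> f c"
    and "\<forall>\<^sub>F n in sequentially.
      integrable lborel (\<lambda>x. indicator I x * f x * (real n * tent (real n * (x - c))))"
proof -
  define F where "F x = indicator I x * f x" for x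
  have [measurable]: "F \<in> borel_measurable borel"
    using m unfolding set_borel_measurable_def F_def by simp
  have [measurable]: "tent \<in> borel_measurable borel"
    using borel_measurable_continuous_onI[OF continuous_tent] .
  obtain B where B: "\<And>x. x \<in> {c..b'} \<Longrightarrow> \<bar>f x\<bar> \<le> B"
  proof -
    have "bounded (f ` {c..b'})"
      by (intro compact_imp_bounded compact_continuous_image continuous_on_subset[OF f I(2)]) auto
    then obtain B where "\<forall>y\<in>f ` {c..b'}. norm y \<le> B" unfolding bounded_iff by blast
    then show ?thesis by (intro that[of B]) auto
  qed
  have B0: "B \<ge> 0" using B[of c] c by auto
  have isC: "isCont F c"
  proof -
    have cI: "c \<in> I" using I c by auto
    then have "isCont f c" using f I(1) continuous_on_eq_continuous_at by blast
    moreover have "\<forall>\<^sub>F x in nhds c. f x = F x"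
      using eventually_nhds_in_open[OF I(1) cI] by eventually_elim (auto simp: F_def)
    ultimately show ?thesis using isCont_cong[of f F c] by blast
  qed
  have Fc: "F c = f c" using subsetD[OF I(2), of c] c by (simp add: F_def)
  have ev: "\<forall>\<^sub>F n in sequentially. real n > 0 \<and> 2 / real n \<le> b' - c"
  proof -
    have "(\<lambda>n. 2 / real n) \<longlonglongrightarrow> 0" by (rule lim_const_over_n)
    then have "\<forall>\<^sub>F n in sequentially. 2 / real n < b' - c"
      using c by (intro order_tendstoD) auto
    then show ?thesis using eventually_gt_at_top[of 0] by eventually_elim auto
  qed
  have bd: "\<bar>F (c + y / real n) * tent y\<bar> \<le> B * indicator {0..2} y"
    if "real n > 0 \<and> 2 / real n \<le> b' - c" for n y
  proof (cases "y \<in> {0..2}")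
    case True
    have "y / real n \<le> 2 / real n" using True that by (simp add: divide_right_mono)
    then have "c + y / real n \<in> {c..b'}" using True that by auto
    then have "\<bar>F (c + y / real n)\<bar> \<le> B"
      using B[of "c + y / real n"] subsetD[OF I(2), of "c + y / real n"] by (simp add: F_def)
    then have "\<bar>F (c + y / real n)\<bar> * tent y \<le> B * 1"
      using tent_bounds[of y] B0 by (intro mult_mono) auto
    then show ?thesis using True tent_bounds[of y] by (auto simp: abs_mult)
  qed (auto simp: tent_outside)
  have subst: "(\<integral>x. F x * (real n * tent (real n * (x - c))) \<partial>lborel) = (\<integral>y. F (c + y / real n) * tent y \<partial>lborel)"
    if "real n > 0" for n
    using that
    by (subst lborel_integral_real_affine[of "1 / real n" _ c]) (auto simp flip: integral_mult_right_zero)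
  have lim: "(\<lambda>n. \<integral>y. F (c + y / real n) * tent y \<partial>lborel) \<longlonglongrightarrow> (\<integral>y. f c * tent y \<partial>lborel)"
  proof -
    obtain N where N: "\<And>n. n \<ge> N \<Longrightarrow> real n > 0 \<and> 2 / real n \<le> b' - c"
      using ev by (auto simp: eventually_sequentially)
    show ?thesis
    \<comment> \<open>The dominating function is valid only once the support, of length 2 / n, fits
      into [c, b']; the shift by \<open>N\<close> makes it valid for every index.\<close>
    proof (rule LIMSEQ_offset[of _ N], rule integral_dominated_convergence)
      show "integrable lborel (\<lambda>y. B * indicator {0..2::real} y :: real)"
        by (intro integrable_mult_right) (auto simp: emeasure_lborel_Icc_eq)
      show "AE y in lborel. norm (F (c + y / real (i + N)) * tent y) \<le> B * indicator {0..2} y" for i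
        using bd[OF N[of "i + N"]] by auto
      show "AE y in lborel. (\<lambda>i. F (c + y / real (i + N)) * tent y) \<longlonglongrightarrow> f c * tent y"
      proof (intro AE_I2 tendsto_mult tendsto_const)
        fix y
        have "(\<lambda>i. c + y / real (i + N)) \<longlonglongrightarrow> c + 0"
          by (intro tendsto_add tendsto_const LIMSEQ_ignore_initial_segment lim_const_over_n)
        then show "(\<lambda>i. F (c + y / real (i + N))) \<longlonglongrightarrow> f c"
          using isCont_tendsto_compose[OF isC] Fc by simp
      qed
    qed auto
  qed
  show "(\<lambda>n. \<integral>x. indicator I x * f x * (real n * tent (real n * (x - c))) \<partial>lborel) \<longlonglongrightarrow> f c"
    unfolding F_def[symmetric]
  proof (rule Lim_transform_eventually)
    show "(\<lambda>n. \<integral>y. F (c + y / real n) * tent y \<partial>lborel) \<longlonglongrightarrow> f c"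
      using lim by (simp add: integral_tent)
    show "\<forall>\<^sub>F n in sequentially. (\<integral>y. F (c + y / real n) * tent y \<partial>lborel) = (\<integral>x. F x * (real n * tent (real n * (x - c))) \<partial>lborel)"
      using ev by eventually_elim (simp add: subst)
  qed
  show "\<forall>\<^sub>F n in sequentially. integrable lborel (\<lambda>x. indicator I x * f x * (real n * tent (real n * (x - c))))"
    unfolding F_def[symmetric]
    using ev
  proof eventually_elim
    case (elim n)
    show ?case
    proof (rule Bochner_Integration.integrable_bound)
      show "integrable lborel (\<lambda>x. B * real n * indicator {c..b'} x :: real)"
        by (intro integrable_mult_right) (auto simp: emeasure_lborel_Icc_eq)
      show "AE x in lborel. norm (F x * (real n * tent (real n * (x - c)))) \<le> norm (B * real n * indicator {c..b'} x)"
      proof (intro AE_I2)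
        fix x
        have eq: "c + (real n * (x - c)) / real n = x" using elim by auto
        have 1: "\<bar>F x * tent (real n * (x - c))\<bar> \<le> B * indicator {0..2} (real n * (x - c))"
          using bd[OF elim, of "real n * (x - c)"] unfolding eq .
        have 2: "real n * (x - c) \<in> {0..2} \<Longrightarrow> x \<in> {c..b'}"
        proof -
          assume *: "real n * (x - c) \<in> {0..2}"
          then have "x - c \<ge> 0" using elim by (auto simp: zero_le_mult_iff)
          moreover have "x - c \<le> 2 / real n" using * elim by (auto simp: field_simps)
          ultimately show ?thesis using elim by auto
        qed
        have "indicator {0..2} (real n * (x - c)) \<le> (indicator {c..b'} x :: real)"
          by (rule indicator_leI[OF 2])
        then have "\<bar>F x * tent (real n * (x - c))\<bar> \<le> B * indicator {c..b'} x"
          using mult_left_mono[OF _ B0] 1 order_trans by blast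
        then have "real n * \<bar>F x * tent (real n * (x - c))\<bar> \<le> real n * (B * indicator {c..b'} x)"
          using elim by (intro mult_left_mono) auto
        then show "norm (F x * (real n * tent (real n * (x - c)))) \<le> norm (B * real n * indicator {c..b'} x)"
          using B0 by (simp add: abs_mult mult_ac)
      qed
    qed auto
  qed
qed

text \<open>Test the weak derivative with the bumps from \<open>a\<close> to \<open>b\<close>: the
  side with \<open>deriv\<close> tends to f a - f b by the averages above, the other side to minus
  the integral of \<open>g\<close> over the interval.\<close>

lemma weak_deriv_FTC:
  fixes f g :: "real \<Rightarrow> real"
  assumes I: "open I" "is_interval I" and f: "continuous_on I f" "set_borel_measurable lborel I f"
    and g: "g \<in> L2_on I" and w: "has_weak_deriv I f g" and ab: "a < b" "a \<in> I" "b \<in> I"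
  shows "f b - f a = (LINT x:{a..b}|lborel. g x)"
proof -
  \<comment> \<open>The descending part of the bump lies to the right of \<open>b\<close>, so it
    needs a point b' > b inside the open interval.\<close>
  obtain e where e: "e > 0" "cball b e \<subseteq> I"
    using I(1) ab(3) open_contains_cball by blast
  define b' where "b' = b + e"
  have b': "b < b'" "b' \<in> I" using e by (auto simp: b'_def cball_def dist_real_def)
  have sub: "{a..b'} \<subseteq> I"
    using mem_is_interval_1_I[OF I(2) ab(2) b'(2)] by auto
  define G where "G x = indicator I x * g x" for x
  have [measurable]: "G \<in> borel_measurable borel"
    using g unfolding set_borel_measurable_def G_def L2_on_def by simp
  have [measurable]: "spline \<in> borel_measurable borel"
    by (intro borel_measurable_continuous_onI continuous_at_imp_continuous_on ballI)
      (use DERIV_spline DERIV_isCont in blast)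
  define \<phi> where "\<phi> n x = spline (real n * (x - a)) - spline (real n * (x - b))" for n x
  have bev: "\<forall>\<^sub>F n in sequentially. real n > 0 \<and> b + 2 / real n \<le> b'"
  proof -
    have "(\<lambda>n. 2 / real n) \<longlonglongrightarrow> 0" by (rule lim_const_over_n)
    then have "\<forall>\<^sub>F n in sequentially. 2 / real n < b' - b"
      using b' by (intro order_tendstoD) auto
    then show ?thesis using eventually_gt_at_top[of 0] by eventually_elim auto
  qed
  have G_int: "integrable lborel (\<lambda>x. \<bar>g x\<bar> * indicator {a..b'} x)"
    using L2_on_set_integrable[OF g sub]
    by (auto simp: set_integrable_def abs_mult mult.commute dest: integrable_abs)
  have test: "\<phi> n \<in> test_functions I" if "real n > 0 \<and> b + 2 / real n \<le> b'" for n
    using spline_bump_test_function[OF _ ab(1) _ sub, of "real n"] that by (simp add: \<phi>_def[abs_def])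
  have dphi: "deriv (\<phi> n) x = real n * tent (real n * (x - a)) - real n * tent (real n * (x - b))" for n x
    unfolding \<phi>_def[abs_def] by (rule DERIV_imp_deriv[OF deriv_spline_bump])
  have A: "(\<lambda>n. LINT x:I|lborel. f x * deriv (\<phi> n) x) \<longlonglongrightarrow> f a - f b"
  proof (rule Lim_transform_eventually)
    have sub': "{b..b'} \<subseteq> I" using sub ab by auto
    have ab': "a < b'" using ab b' by auto
    note ta = tendsto_spline_average[OF I(1) sub ab' f]
    note tb = tendsto_spline_average[OF I(1) sub' b'(1) f]
    show "(\<lambda>n. (\<integral>x. indicator I x * f x * (real n * tent (real n * (x - a))) \<partial>lborel)
        - (\<integral>x. indicator I x * f x * (real n * tent (real n * (x - b))) \<partial>lborel)) \<longlonglongrightarrow> f a - f b"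
      by (intro tendsto_diff ta(1) tb(1))
    show "\<forall>\<^sub>F n in sequentially. (\<integral>x. indicator I x * f x * (real n * tent (real n * (x - a))) \<partial>lborel)
        - (\<integral>x. indicator I x * f x * (real n * tent (real n * (x - b))) \<partial>lborel) =
          (LINT x:I|lborel. f x * deriv (\<phi> n) x)"
      using ta(2) tb(2)
    proof eventually_elim
      case (elim n)
      show ?case
        unfolding Bochner_Integration.integral_diff[OF elim, symmetric] set_lebesgue_integral_def
        by (rule Bochner_Integration.integral_cong) (auto simp: dphi algebra_simps)
    qed
  qed
  have B: "(\<lambda>n. LINT x:I|lborel. g x * \<phi> n x) \<longlonglongrightarrow> (LINT x:{a<..b}|lborel. g x)"
  proof -
    obtain N where N: "\<And>n. n \<ge> N \<Longrightarrow> real n > 0 \<and> b + 2 / real n \<le> b'"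
      using bev by (auto simp: eventually_sequentially)
    have lim: "(\<lambda>n. spline (real (n + N) * (x - c))) \<longlonglongrightarrow> indicator {c<..} x" for x c :: real
    proof (cases "x > c")
      case True
      have "filterlim (\<lambda>n. real (n + N) * (x - c)) at_top sequentially"
        using True by real_asymp
      then have "\<forall>\<^sub>F n in sequentially. real (n + N) * (x - c) \<ge> 2"
        by (auto simp: filterlim_at_top)
      then show ?thesis using True
        by (intro tendsto_eventually) (auto elim!: eventually_mono simp: spline_right)
    next
      case False
      then have "real (n + N) * (x - c) \<le> 0" for n by (auto simp: mult_le_0_iff)
      then show ?thesis using False by (simp add: spline_left)
    qed
    have "(\<lambda>n. \<integral>x. G x * \<phi> (n + N) x \<partial>lborel) \<longlonglongrightarrow> (\<integral>x. G x * indicator {a<..b} x \<partial>lborel)"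
    proof (rule integral_dominated_convergence)
      show "integrable lborel (\<lambda>x. \<bar>g x\<bar> * indicator {a..b'} x)" by (rule G_int)
      show "AE x in lborel. norm (G x * \<phi> (i + N) x) \<le> \<bar>g x\<bar> * indicator {a..b'} x" for i
      proof (intro AE_I2)
        fix x
        have "\<phi> (i + N) x = 0" if "x \<notin> {a..b'}"
        proof -
          have n: "real (i + N) > 0" "b + 2 / real (i + N) \<le> b'" using N[of "i + N"] by auto
          show ?thesis
          proof (cases "x < a")
            case True
            then have "real (i + N) * (x - a) \<le> 0" "real (i + N) * (x - b) \<le> 0"
              using n ab by (auto simp: mult_le_0_iff)
            then show ?thesis by (simp add: \<phi>_def spline_left)
          next
            case False
            then have "2 / real (i + N) \<le> x - b" using that n by auto
            then have "2 \<le> real (i + N) * (x - b)" using n(1) by (simp add: field_simps)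
            moreover have "real (i + N) * (x - b) \<le> real (i + N) * (x - a)" using n ab by simp
            ultimately show ?thesis by (simp add: \<phi>_def spline_right)
          qed
        qed
        moreover have "\<bar>\<phi> (i + N) x\<bar> \<le> 1"
          using spline_bounds unfolding \<phi>_def by (smt (verit))
        then have "\<bar>g x\<bar> * \<bar>\<phi> (i + N) x\<bar> \<le> \<bar>g x\<bar>" using mult_left_le[of "\<bar>\<phi> (i+N) x\<bar>" "\<bar>g x\<bar>"] by simp
        ultimately show "norm (G x * \<phi> (i + N) x) \<le> \<bar>g x\<bar> * indicator {a..b'} x"
          by (auto simp: G_def abs_mult indicator_def)
      qed
      show "AE x in lborel. (\<lambda>i. G x * \<phi> (i + N) x) \<longlonglongrightarrow> G x * indicator {a<..b} x"
      proof (intro AE_I2 tendsto_mult tendsto_const)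
        fix x
        have "(\<lambda>i. \<phi> (i + N) x) \<longlonglongrightarrow> indicator {a<..} x - indicator {b<..} x"
          unfolding \<phi>_def by (intro tendsto_diff lim)
        moreover have "indicator {a<..} x - indicator {b<..} x = (indicator {a<..b} x :: real)"
          using ab by (auto simp: indicator_def)
        ultimately show "(\<lambda>i. \<phi> (i + N) x) \<longlonglongrightarrow> indicator {a<..b} x" by simp
      qed
    qed (auto simp: \<phi>_def)
    then have "(\<lambda>n. LINT x:I|lborel. g x * \<phi> (n + N) x) \<longlonglongrightarrow> (\<integral>x. G x * indicator {a<..b} x \<partial>lborel)"
      by (simp add: set_lebesgue_integral_def G_def mult.assoc)
    moreover have "G x * indicator {a<..b} x = indicator {a<..b} x *\<^sub>R g x" for x
      using subsetD[OF sub, of x] b' by (cases "x \<in> {a<..b}") (simp_all add: G_def)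
    then have "(\<integral>x. G x * indicator {a<..b} x \<partial>lborel) = (LINT x:{a<..b}|lborel. g x)"
      unfolding set_lebesgue_integral_def by (simp only:)
    ultimately have "(\<lambda>n. LINT x:I|lborel. g x * \<phi> (n + N) x) \<longlonglongrightarrow> (LINT x:{a<..b}|lborel. g x)"
      by simp
    then show ?thesis by (rule LIMSEQ_offset)
  qed
  have C: "(\<lambda>n. LINT x:I|lborel. f x * deriv (\<phi> n) x) \<longlonglongrightarrow> - (LINT x:{a<..b}|lborel. g x)"
  proof (rule Lim_transform_eventually[OF tendsto_minus[OF B]])
    show "\<forall>\<^sub>F n in sequentially. - (LINT x:I|lborel. g x * \<phi> n x) = (LINT x:I|lborel. f x * deriv (\<phi> n) x)"
      using bev
    proof eventually_elim
      case (elim n)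
      show ?case using bspec[OF w[unfolded has_weak_deriv_def] test[OF elim]] by simp
    qed
  qed
  have "f a - f b = - (LINT x:{a<..b}|lborel. g x)"
    using LIMSEQ_unique[OF A C] .
  \<comment> \<open>The limit interval is half-open because \<open>spline 0 = 0\<close>: the bump
    vanishes at \<open>a\<close> for every n and tends to 1 at \<open>b\<close>.\<close>
  moreover have "(LINT x:{a<..b}|lborel. g x) = (LINT x:{a..b}|lborel. g x)"
    by (rule set_integral_discrete_difference[of "{a}"]) auto
  ultimately show ?thesis by simp
qed

section \<open>Almost everywhere uniqueness of the derivative\<close>

text \<open>Closed intervals, the empty one included, are stable under intersection and generate the
  Borel sets, and the Borel sets over which \<open>h\<close> integrates to 0 form a Dynkin
  system.\<close>

lemma AE_zero_of_interval_integrals: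
  fixes h :: "real \<Rightarrow> real"
  assumes h: "integrable lborel h" and z: "\<And>a b. (LINT x:{a..b}|lborel. h x) = 0"
  shows "AE x in lborel. h x = 0"
proof (rule sigma_finite_measure.density_zero[OF lborel.sigma_finite_measure_axioms h])
  fix A :: "real set" assume "A \<in> sets lborel"
  then have A: "A \<in> sigma_sets UNIV (range (\<lambda>(a, b). {a..b::real}))"
    unfolding sets_lborel borel_eq_atLeastAtMost by simp
  have stable: "Int_stable (range (\<lambda>(a, b). {a..b::real}))"
    by (auto simp: Int_stable_def image_iff)
  have subset_Pow_UNIV: "range (\<lambda>(a, b). {a..b::real}) \<subseteq> Pow UNIV" by simp
  have borel: "A \<in> sets borel" if "A \<in> sigma_sets UNIV (range (\<lambda>(a, b). {a..b::real}))" for A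
    unfolding borel_eq_atLeastAtMost using that by simp
  have si: "set_integrable lborel A h" if "A \<in> sets borel" for A
    unfolding set_integrable_def using that by (intro integrable_mult_indicator h) auto
  \<comment> \<open>Complements require the integral over the whole line, which is not a compact
    interval and is reached as a limit.\<close>
  have "(\<lambda>i::nat. LINT x:{- real i..real i}|lborel. h x) \<longlonglongrightarrow> (\<integral>x. h x \<partial>lborel)"
    unfolding set_lebesgue_integral_def
  proof (rule integral_dominated_convergence)
    show "integrable lborel (\<lambda>x. \<bar>h x\<bar>)" using h by simp
    show "AE x in lborel. (\<lambda>i. indicator {- real i..real i} x *\<^sub>R h x) \<longlonglongrightarrow> h x"
    proof (intro AE_I2 tendsto_eventually)
      fix x :: real
      obtain N where "\<bar>x\<bar> \<le> real N" using real_arch_simple by blast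
      then have "\<And>i. i \<ge> N \<Longrightarrow> x \<in> {- real i..real i}" by auto
      then show "\<forall>\<^sub>F i in sequentially. indicator {- real i..real i} x *\<^sub>R h x = h x"
        by (auto simp: eventually_sequentially intro!: exI[of _ N])
    qed
  qed (use h in \<open>auto simp: indicator_def\<close>)
  then have all: "(\<integral>x. h x \<partial>lborel) = 0" by (simp add: z LIMSEQ_const_iff)
  show "(LINT x:A|lborel. h x) = 0"
    using stable subset_Pow_UNIV A
  proof (induction rule: sigma_sets_induct_disjoint)
    case (basic A)
    then show ?case using z by auto
  next
    case (compl A)
    have "indicator (UNIV - A) x *\<^sub>R h x = h x - indicator A x *\<^sub>R h x" for x
      by (auto simp: indicator_def)
    then have "(LINT x:UNIV - A|lborel. h x) = (\<integral>x. h x \<partial>lborel) - (LINT x:A|lborel. h x)"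
      using si[OF borel[OF compl(1)]] h by (simp add: set_lebesgue_integral_def set_integrable_def)
    then show ?case using compl all by simp
  next
    case (union A)
    have "(LINT x:(\<Union>i. A i)|lborel. h x) = (\<Sum>i. LINT x:A i|lborel. h x)"
    proof (rule lebesgue_integral_countable_add)
      show "\<And>i. A i \<in> sets lborel" using union(2) borel by auto
      then show "set_integrable lborel (\<Union>i. A i) h" by (intro si) auto
      show "\<And>i j. i \<noteq> j \<Longrightarrow> A i \<inter> A j = {}" using union(1) by (auto simp: disjoint_family_on_def)
    qed
    then show ?case using union by simp
  qed (auto simp: set_lebesgue_integral_def)
qed

text \<open>Absolute continuity in integral form. Unlike \<open>weak_deriv\<close> it involves no
  choice of representative, it survives scaling, and it is the form in which the chain rule consumes
  a derivative.\<close>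

definition ac_pair :: "real set \<Rightarrow> (real \<Rightarrow> real) \<Rightarrow> (real \<Rightarrow> real) \<Rightarrow> bool" where
  "ac_pair I f g \<longleftrightarrow> open I \<and> is_interval I \<and> continuous_on I f \<and> f \<in> L2_on I \<and> g \<in> L2_on I \<and>
     (\<forall>a\<in>I. \<forall>b\<in>I. a \<le> b \<longrightarrow> f b - f a = (LINT x:{a..b}|lborel. g x))"

lemma is_interval_Icc_subset:
  fixes I :: "real set"
  shows "is_interval I \<Longrightarrow> a \<in> I \<Longrightarrow> b \<in> I \<Longrightarrow> {a..b} \<subseteq> I"
  using mem_is_interval_1_I[of I a b] by auto

lemma ac_pairI:
  assumes "open I" "is_interval I" "continuous_on I f" "f \<in> L2_on I" "g \<in> L2_on I"
    and "has_weak_deriv I f g"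
  shows "ac_pair I f g"
proof -
  have "f b - f a = (LINT x:{a..b}|lborel. g x)" if "a \<in> I" "b \<in> I" "a \<le> b" for a b
  proof (cases "a = b")
    case True
    have "(LINT x:{b..b}|lborel. g x) = (LINT x:{}|lborel. g x)"
      by (rule set_integral_discrete_difference[of "{b}"]) auto
    then show ?thesis using True by (simp add: set_lebesgue_integral_def)
  next
    case False
    then show ?thesis
      using weak_deriv_FTC[OF assms(1-3) _ assms(5,6), of a b] assms(4) that
      by (auto simp: L2_on_def)
  qed
  then show ?thesis using assms by (auto simp: ac_pair_def)
qed

text \<open>On a compact subinterval the difference of the two derivatives integrates to 0 over
  every interval, so it vanishes almost everywhere there.\<close>

lemma ac_pair_unique:
  assumes "ac_pair I f g1" "ac_pair I f g2"
  shows "AE x in lborel. x \<in> I \<longrightarrow> g1 x = g2 x"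
proof -
  have I: "open I" "is_interval I" and L: "g1 \<in> L2_on I" "g2 \<in> L2_on I"
    using assms by (auto simp: ac_pair_def)
  have *: "AE x in lborel. x \<in> {q..r} \<longrightarrow> g1 x = g2 x" if qr: "q \<in> I" "r \<in> I" for q r
  proof -
    have sub: "{q..r} \<subseteq> I" using is_interval_Icc_subset[OF I(2) qr] .
    define h where "h x = indicator {q..r} x *\<^sub>R (g1 x - g2 x)" for x
    have si: "set_integrable lborel A g1" "set_integrable lborel A g2"
      if "A \<subseteq> {q..r}" "A \<in> sets borel" for A
      using set_integrable_subset[OF L2_on_set_integrable[OF _ sub] _ that(1)] L that(2) by auto
    have "AE x in lborel. h x = 0"
    proof (rule AE_zero_of_interval_integrals)
      show "integrable lborel h"
        unfolding h_def using set_integral_diff(1)[OF si[of "{q..r}"]] by (simp add: set_integrable_def)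
      fix a b
      have eq: "{a..b} \<inter> {q..r} = {max a q..min b r}" by auto
      have "(LINT x:{a..b}|lborel. h x) = (LINT x:{max a q..min b r}|lborel. g1 x - g2 x)"
        unfolding set_lebesgue_integral_def h_def eq[symmetric]
        by (rule Bochner_Integration.integral_cong) (auto simp: indicator_def)
      also have "\<dots> = (LINT x:{max a q..min b r}|lborel. g1 x) - (LINT x:{max a q..min b r}|lborel. g2 x)"
        by (intro set_integral_diff(2) si) auto
      also have "\<dots> = 0"
      proof (cases "max a q \<le> min b r")
        case True
        then have "max a q \<in> {q..r}" "min b r \<in> {q..r}" by auto
        then have "max a q \<in> I" "min b r \<in> I" using sub by blast+
        then show ?thesis using assms True unfolding ac_pair_def by (metis diff_self)
      qed (simp add: set_lebesgue_integral_def)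
      finally show "(LINT x:{a..b}|lborel. h x) = 0" .
    qed
    then show ?thesis by eventually_elim (auto simp: h_def)
  qed
  \<comment> \<open>Rational end points exhaust the open interval by countably many compact ones, so
    the exceptional null sets can be united.\<close>
  have "AE x in lborel. \<forall>q\<in>\<rat> \<inter> I. \<forall>r\<in>\<rat> \<inter> I. x \<in> {q..r} \<longrightarrow> g1 x = g2 x"
    by (intro AE_ball_countable' * countable_Int1 countable_rat) auto
  then show ?thesis
  proof eventually_elim
    case (elim x)
    show ?case
    proof
      assume "x \<in> I"
      then obtain e where e: "e > 0" "ball x e \<subseteq> I" using I(1) open_contains_ball by blast
      obtain q where q: "q \<in> \<rat>" "x - e < q" "q < x" using Rats_dense_in_real[of "x - e" x] e by auto
      obtain r where r: "r \<in> \<rat>" "x < r" "r < x + e" using Rats_dense_in_real[of x "x + e"] e by auto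
      have "q \<in> I" "r \<in> I" using e(2) q r by (auto simp: subset_eq ball_def dist_real_def)
      then show "g1 x = g2 x" using elim[rule_format, of q r] q r by auto
    qed
  qed
qed

text \<open>This chain rule for absolutely continuous functions avoids almost everywhere
  differentiability: locally it is the mean value theorem, and both sides are additive.\<close>

lemma chain_rule_bound:
  fixes f g H h :: "real \<Rightarrow> real"
  assumes "a \<le> b" and f: "continuous_on {a..b} f" and g: "set_integrable lborel {a..b} g"
    and FTC: "\<And>x y. a \<le> x \<Longrightarrow> x \<le> y \<Longrightarrow> y \<le> b \<Longrightarrow> f y - f x = (LINT t:{x..y}|lborel. g t)"
    and H: "\<And>s. (H has_real_derivative h s) (at s)" and h: "continuous_on UNIV h"
  shows "\<bar>H (f b) - H (f a)\<bar> \<le> (LINT x:{a..b}|lborel. \<bar>h (f x)\<bar> * \<bar>g x\<bar>)"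
proof -
  define k where "k x = \<bar>h (f x)\<bar>" for x
  have k: "continuous_on {a..b} k"
    unfolding k_def by (intro continuous_intros continuous_on_compose2[OF h f]) auto
  have gi: "set_integrable lborel {x..y} (\<lambda>t. \<bar>g t\<bar>)" if "a \<le> x" "y \<le> b" for x y
    using set_integrable_subset[OF set_integrable_abs[OF g], of "{x..y}"] that by auto
  have kgi: "set_integrable lborel {x..y} (\<lambda>t. k t * \<bar>g t\<bar>)" if "a \<le> x" "y \<le> b" for x y
  proof -
    have "bounded (k ` {a..b})" by (intro compact_imp_bounded compact_continuous_image k) auto
    then obtain B where B: "\<forall>t\<in>k ` {a..b}. norm t \<le> B" unfolding bounded_iff by blast
    have km: "(\<lambda>t. indicator {a..b} t *\<^sub>R k t) \<in> borel_measurable borel"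
      using k by (intro borel_measurable_continuous_on_indicator) auto
    have gm: "(\<lambda>t. indicator {a..b} t *\<^sub>R \<bar>g t\<bar>) \<in> borel_measurable borel"
      using borel_measurable_integrable[OF set_integrable_abs[OF g, unfolded set_integrable_def]] by simp
    have eq: "indicator {a..b} t *\<^sub>R (k t * \<bar>g t\<bar>) = (indicator {a..b} t *\<^sub>R k t) * (indicator {a..b} t *\<^sub>R \<bar>g t\<bar>)" for t
      by (auto simp: indicator_def)
    have "set_integrable lborel {a..b} (\<lambda>t. k t * \<bar>g t\<bar>)"
      unfolding set_integrable_def
    proof (rule Bochner_Integration.integrable_bound)
      show "integrable lborel (\<lambda>t. B * (indicator {a..b} t *\<^sub>R \<bar>g t\<bar>))"
        using gi[of a b] by (intro integrable_mult_right) (auto simp: set_integrable_def)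
      show "(\<lambda>t. indicator {a..b} t *\<^sub>R (k t * \<bar>g t\<bar>)) \<in> borel_measurable lborel"
        unfolding eq using km gm by simp
      have "k t * \<bar>g t\<bar> \<le> \<bar>B\<bar> * \<bar>g t\<bar>" if "t \<in> {a..b}" for t
        using B that by (intro mult_right_mono) force+
      then show "AE t in lborel. norm (indicator {a..b} t *\<^sub>R (k t * \<bar>g t\<bar>)) \<le> norm (B * (indicator {a..b} t *\<^sub>R \<bar>g t\<bar>))"
        by (auto simp: indicator_def abs_mult k_def)
    qed
    then show ?thesis by (rule set_integrable_subset) (use that in auto)
  qed
  have split: "(LINT t:{x..z}|lborel. u t) = (LINT t:{x..y}|lborel. u t) + (LINT t:{y..z}|lborel. u t)"
    if "x \<le> y" "y \<le> z" "set_integrable lborel {x..y} u" "set_integrable lborel {y..z} u" for x y z and u :: "real \<Rightarrow> real"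
  proof -
    have "(LINT t:{x..y} \<union> {y..z}|lborel. u t) = (LINT t:{x..y}|lborel. u t) + (LINT t:{y..z}|lborel. u t)"
      by (rule set_integral_Un_AE) (use that AE_lborel_singleton[of y] in \<open>auto elim!: eventually_mono\<close>)
    then show ?thesis using that by (simp add: ivl_disj_un_two_touch)
  qed
  \<comment> \<open>The slack \<open>e\<close> pays for the oscillation of \<open>k\<close> on a
    short interval and is sent to 0 at the end.\<close>
  have eps: "\<bar>H (f b) - H (f a)\<bar> \<le> (LINT t:{a..b}|lborel. (k t + e) * \<bar>g t\<bar>)" if e: "e > 0" for e
  proof -
    have kei: "set_integrable lborel {x..y} (\<lambda>t. (k t + e) * \<bar>g t\<bar>)" if "a \<le> x" "y \<le> b" for x y
      using set_integral_add(1)[OF kgi[OF that] set_integrable_mult_right[OF gi[OF that], of e]]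
      by (simp add: algebra_simps)
    \<comment> \<open>Bolzano's principle also proposes intervals that stick out of [a, b]; on those
      \<open>Q\<close> holds vacuously.\<close>
    define Q where "Q x y \<longleftrightarrow> (a \<le> x \<longrightarrow> x \<le> y \<longrightarrow> y \<le> b \<longrightarrow>
      \<bar>H (f y) - H (f x)\<bar> \<le> (LINT t:{x..y}|lborel. (k t + e) * \<bar>g t\<bar>))" for x y
    have "Q a b"
      using \<open>a \<le> b\<close>
    proof (induction rule: Bolzano)
      case (trans x y z)
      show ?case
        unfolding Q_def
      proof (intro impI)
        assume "a \<le> x" "x \<le> z" "z \<le> b"
        then show "\<bar>H (f z) - H (f x)\<bar> \<le> (LINT t:{x..z}|lborel. (k t + e) * \<bar>g t\<bar>)"
          using trans split[OF trans(3,4) kei kei] unfolding Q_def by auto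
      qed
    next
      case (local z)
      have "\<exists>d>0. \<forall>t\<in>{a..b}. dist t z < d \<longrightarrow> dist (k t) (k z) < e / 2"
        using k local e unfolding continuous_on_iff by (meson atLeastAtMost_iff half_gt_zero)
      then obtain d where d: "d > 0" "\<And>t. t \<in> {a..b} \<Longrightarrow> dist t z < d \<Longrightarrow> \<bar>k t - k z\<bar> < e / 2"
        by (auto simp: dist_real_def)
      show ?case
      proof (intro exI[of _ d] conjI allI impI d(1))
        fix x y assume xy: "x \<le> z \<and> z \<le> y \<and> y - x < d"
        show "Q x y"
          unfolding Q_def
        proof (intro impI)
          assume *: "a \<le> x" "x \<le> y" "y \<le> b"
          have osc: "k s \<le> k t + e" if "s \<in> {x..y}" "t \<in> {x..y}" for s t
          proof -
            have "\<bar>k s - k z\<bar> < e / 2" "\<bar>k t - k z\<bar> < e / 2"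
              by (rule d(2); use that * xy in \<open>auto simp: dist_real_def\<close>)+
            then show ?thesis by linarith
          qed
          \<comment> \<open>Mean value theorem for \<open>H\<close> between the values of
            \<open>f\<close>, whichever of the two is larger.\<close>
          obtain \<xi> where \<xi>: "\<xi> \<in> closed_segment (f x) (f y)" "\<bar>H (f y) - H (f x)\<bar> \<le> \<bar>h \<xi>\<bar> * \<bar>f y - f x\<bar>"
          proof -
            consider "f x < f y" | "f x > f y" | "f x = f y" by linarith
            then show ?thesis
            proof cases
              case 1
              from MVT2[OF this, of H h] H obtain z where "f x < z" "z < f y" "H (f y) - H (f x) = (f y - f x) * h z" by blast
              then show ?thesis using 1 by (intro that[of z]) (auto simp: closed_segment_eq_real_ivl abs_mult)
            next
              case 2
              from MVT2[OF this, of H h] H obtain z where "f y < z" "z < f x" and z: "H (f x) - H (f y) = (f x - f y) * h z" by blast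
              moreover have "\<bar>H (f y) - H (f x)\<bar> = \<bar>h z\<bar> * \<bar>f y - f x\<bar>"
                using arg_cong[OF z, of abs] by (simp add: abs_mult abs_minus_commute mult.commute)
              ultimately show ?thesis using 2 by (intro that[of z]) (auto simp: closed_segment_eq_real_ivl)
            qed (auto intro: that[of "f x"])
          qed
          \<comment> \<open>The intermediate value theorem writes the mean value point as a value of
            \<open>f\<close>, which turns |h xi| into \<open>k s\<close>; the oscillation bound then
            compares \<open>k s\<close> with \<open>k t\<close> under the integral.\<close>
          obtain s where s: "s \<in> {x..y}" "f s = \<xi>"
          proof -
            have "connected (f ` {x..y})"
              by (intro connected_continuous_image continuous_on_subset[OF f]) (use * in auto)
            then have "closed_segment (f x) (f y) \<subseteq> f ` {x..y}"
              using * by (intro closed_segment_subset) (auto simp flip: connected_convex_1)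
            then show ?thesis using \<xi>(1) that by auto
          qed
          have "\<bar>H (f y) - H (f x)\<bar> \<le> k s * \<bar>LINT t:{x..y}|lborel. g t\<bar>"
            using \<xi>(2) FTC[of x y] * s by (simp add: k_def)
          also have "\<dots> \<le> k s * (LINT t:{x..y}|lborel. \<bar>g t\<bar>)"
          proof (rule mult_left_mono)
            show "\<bar>LINT t:{x..y}|lborel. g t\<bar> \<le> (LINT t:{x..y}|lborel. \<bar>g t\<bar>)"
              using integral_abs_bound[of lborel "\<lambda>t. indicator {x..y} t *\<^sub>R g t"]
              by (simp add: set_lebesgue_integral_def abs_mult)
          qed (simp add: k_def)
          also have "\<dots> = (LINT t:{x..y}|lborel. k s * \<bar>g t\<bar>)" by simp
          also have "\<dots> \<le> (LINT t:{x..y}|lborel. (k t + e) * \<bar>g t\<bar>)"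
            using osc[OF s(1)] *
            by (intro set_integral_mono set_integrable_mult_right gi kei mult_right_mono) auto
          finally show "\<bar>H (f y) - H (f x)\<bar> \<le> (LINT t:{x..y}|lborel. (k t + e) * \<bar>g t\<bar>)" .
        qed
      qed
    qed
    then show ?thesis using \<open>a \<le> b\<close> by (simp add: Q_def)
  qed
  define Kg where "Kg = (LINT t:{a..b}|lborel. \<bar>g t\<bar>)"
  have eq: "(LINT t:{a..b}|lborel. (k t + e) * \<bar>g t\<bar>) = (LINT t:{a..b}|lborel. k t * \<bar>g t\<bar>) + e * Kg" for e
    using set_integral_add(2)[OF kgi[of a b] set_integrable_mult_right[OF gi[of a b], of e]]
    by (simp add: algebra_simps Kg_def)
  have "\<bar>H (f b) - H (f a)\<bar> \<le> (LINT t:{a..b}|lborel. k t * \<bar>g t\<bar>)"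
  proof (rule tendsto_lowerbound[of _ _ "at_right 0"])
    show "((\<lambda>e. (LINT t:{a..b}|lborel. k t * \<bar>g t\<bar>) + e * Kg) \<longlongrightarrow> (LINT t:{a..b}|lborel. k t * \<bar>g t\<bar>)) (at_right 0)"
      by (rule tendsto_eq_intros refl | simp)+
    show "\<forall>\<^sub>F e in at_right 0. \<bar>H (f b) - H (f a)\<bar> \<le> (LINT t:{a..b}|lborel. k t * \<bar>g t\<bar>) + e * Kg"
      using eps eq by (auto simp: eventually_at_filter)
  qed auto
  then show ?thesis by (simp add: k_def)
qed

section \<open>The potential and the soliton\<close>

locale gns_exponent =
  fixes p :: real
  assumes p: "p > 2"
begin

text \<open>Twice the square root in the overview. The radicand is negative for |s| > 1; clamping it
  at 0 gives an even continuous function on the whole line, so that it has a global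
  primitive.\<close>

definition slope :: "real \<Rightarrow> real" where
  "slope s = 2 * sqrt (max 0 (s\<^sup>2 - \<bar>s\<bar> powr p))"

lemma continuous_slope: "continuous_on UNIV slope"
  unfolding slope_def[abs_def] using p
  by (intro continuous_intros continuous_on_max continuous_on_powr') auto

lemma slope_nonneg: "slope s \<ge> 0"
  by (simp add: slope_def)

lemma slope_minus [simp]: "slope (- s) = slope s"
  by (simp add: slope_def)

lemma powr_le_square:
  assumes "\<bar>s\<bar> \<le> 1" shows "\<bar>s\<bar> powr p \<le> s\<^sup>2"
proof (cases "s = 0")
  case False
  then have "\<bar>s\<bar> powr p \<le> \<bar>s\<bar> powr 2" using assms p by (intro powr_mono') auto
  then show ?thesis by simp
qed (use p in simp)

lemma powr_less_square:
  assumes "0 < s" "s < 1" shows "\<bar>s\<bar> powr p < s\<^sup>2"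
proof -
  have "\<bar>s\<bar> powr p < \<bar>s\<bar> powr 2" using assms p by (intro powr_less_mono') auto
  then show ?thesis by simp
qed

lemma slope_pos: "0 < s \<Longrightarrow> s < 1 \<Longrightarrow> slope s > 0"
  using powr_less_square[of s] by (simp add: slope_def)

lemma completing_the_square:
  assumes "\<bar>s\<bar> \<le> 1"
  shows "d\<^sup>2 + s\<^sup>2 - \<bar>s\<bar> powr p = (\<bar>d\<bar> - slope s / 2)\<^sup>2 + slope s * \<bar>d\<bar>"
proof -
  have "(slope s / 2)\<^sup>2 = s\<^sup>2 - \<bar>s\<bar> powr p"
    using powr_le_square[OF assms] by (simp add: slope_def)
  then show ?thesis by (simp add: power2_eq_square algebra_simps)
qed

text \<open>This linear growth has two uses: it makes \<open>slope\<close> of an L^2 function times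
  an L^2 function integrable, and in the equality case it yields |f'| <= |f|.\<close>

lemma slope_le: "slope s \<le> 2 * \<bar>s\<bar>"
proof -
  have "sqrt (max 0 (s\<^sup>2 - \<bar>s\<bar> powr p)) \<le> sqrt (s\<^sup>2)"
    by (intro real_sqrt_le_mono) auto
  then show ?thesis by (simp add: slope_def)
qed

definition pot :: "real \<Rightarrow> real" where
  "pot = (SOME F. F 0 = 0 \<and> (\<forall>s. (F has_real_derivative slope s) (at s)))"

lemma pot_0 [simp]: "pot 0 = 0" and DERIV_pot: "(pot has_real_derivative slope s) (at s)"
proof -
  have "isCont slope s" for s
    using continuous_slope by (simp add: continuous_on_eq_continuous_at)
  then obtain F where F: "\<And>s. (F has_vector_derivative slope s) (at s)"
    using einterval_antiderivative[of "-\<infinity>" "\<infinity>" slope] by auto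
  have "\<exists>F. F 0 = 0 \<and> (\<forall>s. (F has_real_derivative slope s) (at s))"
  proof (intro exI[of _ "\<lambda>s. F s - F 0"] conjI allI)
    show "((\<lambda>s. F s - F 0) has_real_derivative slope s) (at s)" for s
      using DERIV_diff[OF F[unfolded has_real_derivative_iff_has_vector_derivative[symmetric]] DERIV_const]
      by simp
  qed simp
  from someI_ex[OF this] show "pot 0 = 0" "(pot has_real_derivative slope s) (at s)"
    unfolding pot_def by auto
qed

text \<open>As \<open>slope\<close> is even, the derivative of pot s + pot (- s) vanishes
  identically.\<close>

lemma pot_minus: "pot (- s) = - pot s"
proof -
  have "((\<lambda>s. pot s + pot (- s)) has_real_derivative 0) (at s)" for s
  proof -
    have "((\<lambda>s. pot (- s)) has_real_derivative slope (- s) * (-1)) (at s)"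
      by (rule DERIV_chain2[OF DERIV_pot]) (auto intro!: derivative_eq_intros)
    from DERIV_add[OF DERIV_pot[of s] this] show ?thesis by simp
  qed
  from DERIV_isconst_all[OF allI[OF this], of s 0] show ?thesis by simp
qed

lemma pot_mono: "s \<le> t \<Longrightarrow> pot s \<le> pot t"
  using DERIV_nonneg_imp_nondecreasing[of s t pot] DERIV_pot slope_nonneg by blast

lemma abs_pot: "\<bar>pot s\<bar> = pot \<bar>s\<bar>"
proof (cases "s \<ge> 0")
  case True
  then show ?thesis using pot_mono[of 0 s] by simp
next
  case False
  then show ?thesis using pot_mono[of s 0] pot_minus[of s] by simp
qed

lemma pot_pos:
  assumes "s > 0" shows "pot s > 0"
proof -
  have c: "continuous_on {a..b} pot" for a b
    by (rule DERIV_continuous_on[OF has_field_derivative_at_within[OF DERIV_pot]])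
  \<comment> \<open>\<open>slope\<close> is positive only strictly between 0 and 1 on the positive
    axis, hence the comparison point at most 1/2.\<close>
  have "pot 0 < pot (min s (1 / 2))"
  proof (rule DERIV_pos_imp_increasing_open[of 0 "min s (1 / 2)" pot])
    fix x :: real assume "0 < x" "x < min s (1 / 2)"
    then show "\<exists>y. (pot has_real_derivative y) (at x) \<and> 0 < y"
      using DERIV_pot slope_pos[of x] by auto
  qed (use assms c in auto)
  also have "\<dots> \<le> pot s" by (rule pot_mono) simp
  finally show ?thesis by simp
qed

lemma isCont_pot: "isCont pot s"
  using DERIV_pot DERIV_isCont by blast

text \<open>\<open>mass\<close> and \<open>energy\<close> are the \<open>p\<close>-th power integral and the energy of the soliton below; integrating
  the derivative of \<open>soliton\<^sup>2 * tanh\<close> expresses both through \<open>pot 1\<close>.\<close>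

definition mass :: real where
  "mass = 4 * pot 1 / (p - 2)"

definition energy :: real where
  "energy = 2 * pot 1 + mass"

text \<open>The quotient of energy and squared L^p norm at the soliton; it turns out to be the
  reciprocal of both best constants.\<close>

definition gns_const :: real where
  "gns_const = energy / mass powr (2 / p)"

lemma mass_pos: "mass > 0"
  using p pot_pos[of 1] by (simp add: mass_def)

lemma energy_pos: "energy > 0"
  using mass_pos pot_pos[of 1] by (simp add: energy_def)

lemma gns_const_pos: "gns_const > 0"
  using mass_pos energy_pos by (simp add: gns_const_def)

text \<open>The concave power r^(2/p) lies below its tangent at r = 1. With r = J / mass, contact
  occurs exactly at the mass of the soliton, which makes the bound sharp.\<close>

lemma gns_const_bound:
  assumes "J > 0" shows "gns_const * J powr (2 / p) \<le> 2 * pot 1 + J"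
proof -
  define r where "r = J / mass"
  have r: "r > 0" "J = mass * r" using assms mass_pos by (auto simp: r_def)
  have "1 powr (1 - 2 / p) * r powr (2 / p) \<le> (1 - 2 / p) * 1 + (2 / p) * r"
    using p r by (intro Youngs_inequality_0) auto
  then have "energy * r powr (2 / p) \<le> energy * ((1 - 2 / p) + (2 / p) * r)"
    using energy_pos by simp
  \<comment> \<open>Since energy = 2 p pot 1 / (p - 2), the weights 1 - 2/p and 2/p turn it into 2
    pot 1 and \<open>mass\<close>.\<close>
  also have "\<dots> = 2 * pot 1 + mass * r"
    using p by (simp add: energy_def mass_def field_simps)
  finally show ?thesis
    using r mass_pos by (simp add: gns_const_def powr_mult)
qed

section \<open>The soliton and its truncated integrals\<close>

definition rate :: real where
  "rate = (p - 2) / 2"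

lemma rate_pos: "rate > 0"
  using p by (simp add: rate_def)

text \<open>The soliton \<open>cosh (rate * x) powr (- 1 / rate)\<close>, the extremal function on the line.\<close>

definition soliton :: "real \<Rightarrow> real" where
  "soliton x = exp (- (ln (cosh (rate * x)) / rate))"

lemma soliton_pos: "soliton x > 0" and soliton_le_1: "soliton x \<le> 1" and soliton_0: "soliton 0 = 1"
  and soliton_minus [simp]: "soliton (- x) = soliton x"
  using rate_pos by (auto simp: soliton_def cosh_real_ge_1)

lemma DERIV_soliton: "(soliton has_real_derivative - (tanh (rate * x) * soliton x)) (at x)"
  unfolding soliton_def[abs_def] tanh_def using rate_pos cosh_real_pos[of "rate * x"]
  by (auto intro!: derivative_eq_intros simp: field_simps)

text \<open>From p = 2 rate + 2, the p-th power of u = soliton is u^2 / cosh^2. With u' = - tanh * u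
  this is the first integral u'^2 = u^2 - u^p of the soliton equation.\<close>

lemma soliton_powr: "soliton x powr p = (1 - (tanh (rate * x))\<^sup>2) * (soliton x)\<^sup>2"
proof -
  have c: "cosh (rate * x) > 0" by (rule cosh_real_pos)
  have p': "p / rate = 2 / rate + 2" using p by (simp add: rate_def field_simps)
  have "soliton x powr p = exp (2 * (- (ln (cosh (rate * x)) / rate)) - 2 * ln (cosh (rate * x)))"
  proof -
    have "p * (- (l / rate)) = 2 * (- (l / rate)) - 2 * l" for l
      using arg_cong[OF p', of "\<lambda>q. q * l"] by (simp add: algebra_simps)
    then show ?thesis unfolding soliton_def powr_def by simp
  qed
  also have "\<dots> = (soliton x)\<^sup>2 / (cosh (rate * x))\<^sup>2"
  proof -
    have "exp (2 * t) = (exp t)\<^sup>2" for t :: real by (simp add: power2_eq_square exp_add[symmetric])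
    then show ?thesis using c unfolding soliton_def exp_diff by (simp only: exp_ln)
  qed
  also have "\<dots> = (1 - (tanh (rate * x))\<^sup>2) * (soliton x)\<^sup>2"
  proof -
    have "1 - (tanh (rate * x))\<^sup>2 = 1 / (cosh (rate * x))\<^sup>2"
      using c hyperbolic_pythagoras[of "rate * x"]
        diff_divide_distrib[of "(cosh (rate * x))\<^sup>2" "(sinh (rate * x))\<^sup>2" "(cosh (rate * x))\<^sup>2"]
      by (simp add: tanh_def power_divide)
    then show ?thesis by simp
  qed
  finally show ?thesis .
qed

text \<open>Equivalently |u'| = slope u / 2 for the soliton u: the square left over on completing
  the square vanishes for it.\<close>

lemma slope_soliton: "slope (soliton x) = 2 * \<bar>tanh (rate * x)\<bar> * soliton x"
proof -
  have "(soliton x)\<^sup>2 - \<bar>soliton x\<bar> powr p = (tanh (rate * x) * soliton x)\<^sup>2"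
    using soliton_powr[of x] soliton_pos[of x] by (simp add: algebra_simps power_mult_distrib)
  then show ?thesis using soliton_pos[of x] by (simp add: slope_def abs_mult)
qed

lemma isCont_soliton: "isCont soliton x" and isCont_tanh_rate: "isCont (\<lambda>x. tanh (rate * x)) x"
  using DERIV_soliton DERIV_isCont by (blast, intro continuous_intros) simp

lemma continuous_on_soliton: "continuous_on A soliton"
  using isCont_soliton by (simp add: continuous_at_imp_continuous_on)

lemma continuous_on_tanh_rate: "continuous_on A (\<lambda>x. tanh (rate * x))"
  using isCont_tanh_rate by (simp add: continuous_at_imp_continuous_on)

definition kinetic :: "real \<Rightarrow> real" where
  "kinetic L = (LINT x:{- L..L}|lborel. (tanh (rate * x) * soliton x)\<^sup>2)"

definition soliton_mass :: "real \<Rightarrow> real" where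
  "soliton_mass L = (LINT x:{- L..L}|lborel. soliton x powr p)"

lemma set_integrable_soliton:
  "set_integrable lborel {a..b} (\<lambda>x. (tanh (rate * x) * soliton x)\<^sup>2)"
  "set_integrable lborel {a..b} (\<lambda>x. soliton x powr p)"
  unfolding soliton_powr
  by (auto intro!: borel_integrable_atLeastAtMost' continuous_intros continuous_on_soliton)

lemma set_integral_FTC:
  fixes F f :: "real \<Rightarrow> real"
  assumes "a \<le> b" "\<And>x. a \<le> x \<Longrightarrow> x \<le> b \<Longrightarrow> (F has_real_derivative f x) (at x)"
    and "\<And>x. a \<le> x \<Longrightarrow> x \<le> b \<Longrightarrow> isCont f x"
  shows "(LINT x:{a..b}|lborel. f x) = F b - F a"
  using integral_FTC_Icc_real[OF assms] by (simp add: set_lebesgue_integral_def mult.commute)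

text \<open>On each half-line u is monotone and u'^2 = (slope u / 2) |u'|, which up to sign is the
  derivative of pot u / 2. The sign of tanh changes at 0, hence the split there.\<close>

lemma kinetic_eq:
  assumes "L > 0" shows "kinetic L = pot 1 - pot (soliton L)"
proof -
  have D: "((\<lambda>x. pot (soliton x)) has_real_derivative
      2 * \<bar>tanh (rate * x)\<bar> * soliton x * (- (tanh (rate * x) * soliton x))) (at x)" for x
    using DERIV_chain2[OF DERIV_pot DERIV_soliton] by (simp add: slope_soliton)
  have c: "isCont (\<lambda>x. (tanh (rate * x) * soliton x)\<^sup>2) x" for x
    by (intro continuous_intros isCont_soliton isCont_tanh_rate)
  have right: "(LINT x:{0..L}|lborel. (tanh (rate * x) * soliton x)\<^sup>2) =
      - pot (soliton L) / 2 - - pot (soliton 0) / 2"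
  proof (rule set_integral_FTC)
    fix x assume "0 \<le> x" "x \<le> L"
    then have "\<bar>tanh (rate * x)\<bar> = tanh (rate * x)" using rate_pos by simp
    then show "((\<lambda>x. - pot (soliton x) / 2) has_real_derivative (tanh (rate * x) * soliton x)\<^sup>2) (at x)"
      using DERIV_cdivide[OF DERIV_minus[OF D[of x]], of 2] by (simp add: power2_eq_square mult_ac)
  qed (use assms c in auto)
  have left: "(LINT x:{-L..0}|lborel. (tanh (rate * x) * soliton x)\<^sup>2) =
      pot (soliton 0) / 2 - pot (soliton (- L)) / 2"
  proof (rule set_integral_FTC)
    fix x assume "- L \<le> x" "x \<le> 0"
    then have "rate * x \<le> 0" using rate_pos by (simp add: mult_le_0_iff)
    then have "tanh (rate * x) \<le> 0" by simp
    then have "\<bar>tanh (rate * x)\<bar> = - tanh (rate * x)" by simp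
    then show "((\<lambda>x. pot (soliton x) / 2) has_real_derivative (tanh (rate * x) * soliton x)\<^sup>2) (at x)"
      using DERIV_cdivide[OF D[of x], of 2] by (simp add: power2_eq_square mult_ac)
  qed (use assms c in auto)
  have "(LINT x:{-L..0} \<union> {0..L}|lborel. (tanh (rate * x) * soliton x)\<^sup>2) =
      (LINT x:{-L..0}|lborel. (tanh (rate * x) * soliton x)\<^sup>2) + (LINT x:{0..L}|lborel. (tanh (rate * x) * soliton x)\<^sup>2)"
    by (rule set_integral_Un_AE)
      (use AE_lborel_singleton[of 0] set_integrable_soliton in \<open>auto elim!: eventually_mono\<close>)
  then show ?thesis
    using left right assms unfolding kinetic_def by (simp add: ivl_disj_un_two_touch soliton_0)
qed

text \<open>The derivative of u^2 tanh (rate x) is rate u^p - 2 u'^2. The boundary term disappears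
  as L grows, leaving rate * mass = 2 pot 1.\<close>

lemma soliton_mass_eq:
  assumes "L > 0"
  shows "rate * soliton_mass L = 2 * kinetic L + 2 * (soliton L)\<^sup>2 * tanh (rate * L)"
proof -
  have "(LINT x:{-L..L}|lborel. rate * soliton x powr p - 2 * (tanh (rate * x) * soliton x)\<^sup>2) =
      (soliton L)\<^sup>2 * tanh (rate * L) - (soliton (- L))\<^sup>2 * tanh (rate * (- L))"
  proof (rule set_integral_FTC)
    fix x
    show "((\<lambda>x. (soliton x)\<^sup>2 * tanh (rate * x)) has_real_derivative
        rate * soliton x powr p - 2 * (tanh (rate * x) * soliton x)\<^sup>2) (at x)"
      unfolding soliton_powr
      by (rule derivative_eq_intros DERIV_soliton refl | simp)+
        (simp_all add: power2_eq_square algebra_simps)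
    show "isCont (\<lambda>x. rate * soliton x powr p - 2 * (tanh (rate * x) * soliton x)\<^sup>2) x"
      unfolding soliton_powr by (intro continuous_intros isCont_soliton isCont_tanh_rate)
  qed (use assms in simp)
  moreover have "(LINT x:{-L..L}|lborel. rate * soliton x powr p - 2 * (tanh (rate * x) * soliton x)\<^sup>2) =
      rate * soliton_mass L - 2 * kinetic L"
    using set_integrable_soliton by (subst set_integral_diff(2)) (auto simp: kinetic_def soliton_mass_def)
  ultimately show ?thesis by (simp add: algebra_simps)
qed

section \<open>Decay of the soliton and near optimality of its truncations\<close>

text \<open>Raise cosh y >= exp y / 2 to the power - 1 / rate.\<close>

lemma soliton_decay: "soliton x \<le> exp (ln 2 / rate) * exp (- x)"
proof -
  have "ln (exp (rate * x) / 2) \<le> ln (cosh (rate * x))"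
    by (subst ln_le_cancel_iff) (auto simp: cosh_real_pos cosh_def intro!: add_pos_pos)
  then have "(rate * x - ln 2) / rate \<le> ln (cosh (rate * x)) / rate"
    using rate_pos by (intro divide_right_mono) (auto simp: ln_div)
  then have "- (ln (cosh (rate * x)) / rate) \<le> ln 2 / rate - x"
    using rate_pos by (simp add: diff_divide_distrib)
  then have "soliton x \<le> exp (ln 2 / rate - x)" by (simp add: soliton_def)
  then show ?thesis by (simp add: exp_diff exp_minus field_simps)
qed

text \<open>The second limit controls the L^p mass lost by lowering the soliton by its end value
  over an interval whose length is proportional to n.\<close>

lemma tendsto_soliton: "(\<lambda>n. soliton (real n)) \<longlonglongrightarrow> 0" "(\<lambda>n. real n * soliton (real n)) \<longlonglongrightarrow> 0"
proof -
  have 1: "(\<lambda>n. exp (ln 2 / rate) * exp (- real n)) \<longlonglongrightarrow> 0" by real_asymp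
  show "(\<lambda>n. soliton (real n)) \<longlonglongrightarrow> 0"
    by (rule tendsto_sandwich[OF _ _ tendsto_const 1])
      (use soliton_decay soliton_pos in \<open>auto simp: less_imp_le\<close>)
  have 2: "(\<lambda>n. real n * (exp (ln 2 / rate) * exp (- real n))) \<longlonglongrightarrow> 0" by real_asymp
  show "(\<lambda>n. real n * soliton (real n)) \<longlonglongrightarrow> 0"
    by (rule tendsto_sandwich[OF _ _ tendsto_const 2])
      (auto intro!: always_eventually mult_left_mono soliton_decay simp: soliton_pos less_imp_le)
qed

lemma tendsto_kinetic: "(\<lambda>n. kinetic (real n)) \<longlonglongrightarrow> pot 1"
proof (rule Lim_transform_eventually)
  show "(\<lambda>n. pot 1 - pot (soliton (real n))) \<longlonglongrightarrow> pot 1"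
    using tendsto_diff[OF tendsto_const isCont_tendsto_compose[OF isCont_pot tendsto_soliton(1)]] by simp
  show "\<forall>\<^sub>F n in sequentially. pot 1 - pot (soliton (real n)) = kinetic (real n)"
    using eventually_gt_at_top[of 0] by eventually_elim (simp add: kinetic_eq)
qed

lemma tendsto_soliton_mass: "(\<lambda>n. soliton_mass (real n)) \<longlonglongrightarrow> mass"
proof (rule Lim_transform_eventually)
  have "(\<lambda>n. (soliton (real n))\<^sup>2 * tanh (rate * real n)) \<longlonglongrightarrow> 0"
  proof (rule Lim_null_comparison)
    show "\<forall>\<^sub>F n in sequentially. norm ((soliton (real n))\<^sup>2 * tanh (rate * real n)) \<le> (soliton (real n))\<^sup>2"
    proof (intro always_eventually allI)
      fix n
      have "\<bar>tanh (rate * real n)\<bar> \<le> 1"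
        using tanh_real_bounds[of "rate * real n"] by auto
      then show "norm ((soliton (real n))\<^sup>2 * tanh (rate * real n)) \<le> (soliton (real n))\<^sup>2"
        by (simp add: abs_mult mult_left_le)
    qed
    show "(\<lambda>n. (soliton (real n))\<^sup>2) \<longlonglongrightarrow> 0"
      using tendsto_power[OF tendsto_soliton(1), of 2] by simp
  qed
  then have "(\<lambda>n. (2 * kinetic (real n) + 2 * ((soliton (real n))\<^sup>2 * tanh (rate * real n))) / rate) \<longlonglongrightarrow>
      (2 * pot 1 + 2 * 0) / rate"
    using rate_pos by (intro tendsto_intros tendsto_kinetic) auto
  then show "(\<lambda>n. (2 * kinetic (real n) + 2 * ((soliton (real n))\<^sup>2 * tanh (rate * real n))) / rate) \<longlonglongrightarrow> mass"
    by (simp add: mass_def rate_def)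
  show "\<forall>\<^sub>F n in sequentially. (2 * kinetic (real n) + 2 * ((soliton (real n))\<^sup>2 * tanh (rate * real n))) / rate
      = soliton_mass (real n)"
    using eventually_gt_at_top[of 0]
  proof eventually_elim
    case (elim n)
    then show ?case using soliton_mass_eq[of "real n"] rate_pos by (simp add: field_simps)
  qed
qed

text \<open>Mean value theorem: on (0, 1] the derivative p z^(p-1) is at most p.\<close>

lemma powr_diff_bound:
  assumes "0 \<le> e" "e \<le> s" "s \<le> 1"
  shows "s powr p - p * e \<le> (s - e) powr p"
\<comment> \<open>For e = s the interval would reach 0, while the derivative rule for
  \<open>powr\<close> is applied at positive arguments; for e = 0 it degenerates.\<close>
proof (cases "e = s \<or> e = 0")
  case True
  have "s powr p \<le> s"
    using assms p powr_mono'[of 1 p s] by (cases "s = 0") auto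
  moreover have "1 * s \<le> p * s" using assms p by (intro mult_right_mono) auto
  ultimately show ?thesis using True assms p by auto
next
  case False
  then have e: "0 < e" "e < s" using assms by auto
  have "\<exists>z. s - e < z \<and> z < s \<and> s powr p - (s - e) powr p = (s - (s - e)) * (p * z powr (p - 1))"
  proof (rule MVT2)
    fix x assume "s - e \<le> x" "x \<le> s"
    then have "x > 0" using e by auto
    then show "((\<lambda>x. x powr p) has_real_derivative p * x powr (p - 1)) (at x)"
      by (rule has_real_derivative_powr)
  qed (use e in auto)
  then obtain z where z: "s - e < z" "z < s" "s powr p - (s - e) powr p = e * (p * z powr (p - 1))" by auto
  have "z powr (p - 1) \<le> 1" using z e assms p by (intro powr_le1) auto
  then have "e * (p * z powr (p - 1)) \<le> e * (p * 1)" using e p by (intro mult_left_mono) auto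
  then have "e * (p * z powr (p - 1)) \<le> p * e" by (simp only: mult_1_right mult.commute)
  then show ?thesis using z(3) by linarith
qed

text \<open>Subtracting the end value makes the truncated soliton vanish at both ends. This does not
  increase the energy, and it costs at most p * soliton L in the p-th power at each point.\<close>

lemma near_extremal:
  assumes "K > gns_const"
  obtains L where "L > 0"
    "(LINT x:{- L..L}|lborel. \<bar>soliton x - soliton L\<bar> powr p) > 0"
    "(LINT x:{- L..L}|lborel. (tanh (rate * x) * soliton x)\<^sup>2 + (soliton x - soliton L)\<^sup>2)
       < K * (LINT x:{- L..L}|lborel. \<bar>soliton x - soliton L\<bar> powr p) powr (2 / p)"
proof -
  \<comment> \<open>By the first integral u^2 = u'^2 + u^p, so the truncated energy consists of
    twice the kinetic part and the mass.\<close>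
  define e where "e n = 2 * kinetic (real n) + soliton_mass (real n)" for n
  \<comment> \<open>The subtracted term is the pointwise loss p * soliton n times the length 2 n of
    the interval.\<close>
  define j where "j n = soliton_mass (real n) - 2 * p * (real n * soliton (real n))" for n
  have j: "j \<longlonglongrightarrow> mass"
    unfolding j_def[abs_def]
    using tendsto_diff[OF tendsto_soliton_mass tendsto_mult[OF tendsto_const[of "2 * p"] tendsto_soliton(2)]] by simp
  have e: "e \<longlonglongrightarrow> energy"
    unfolding e_def[abs_def] energy_def by (intro tendsto_intros tendsto_kinetic tendsto_soliton_mass)
  have "(\<lambda>n. e n / j n powr (2 / p)) \<longlonglongrightarrow> gns_const"
    unfolding gns_const_def using mass_pos by (intro tendsto_intros e j) auto
  then have "\<forall>\<^sub>F n in sequentially. e n / j n powr (2 / p) < K"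
    using assms by (rule order_tendstoD)
  moreover have "\<forall>\<^sub>F n in sequentially. j n > 0"
    using j mass_pos by (rule order_tendstoD)
  ultimately have "\<forall>\<^sub>F n in sequentially. e n / j n powr (2 / p) < K \<and> j n > 0 \<and> n > 0"
    using eventually_gt_at_top[of 0] by eventually_elim auto
  then obtain n where n: "e n / j n powr (2 / p) < K" "j n > 0" "n > 0"
    using eventually_happens trivial_limit_sequentially by blast
  define L where "L = real n"
  have L: "L > 0" using n by (simp add: L_def)
  have sL: "soliton L \<le> soliton x" if "x \<in> {-L..L}" for x
  proof -
    have "\<bar>rate * x\<bar> \<le> \<bar>rate * L\<bar>" using that rate_pos L by (auto simp: abs_mult)
    then have "cosh (rate * x) \<le> cosh (rate * L)" by (subst cosh_real_abs[symmetric], subst (2) cosh_real_abs[symmetric])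
      (simp add: cosh_real_nonneg_le_iff del: cosh_real_abs)
    then have "ln (cosh (rate * x)) \<le> ln (cosh (rate * L))" using cosh_real_pos by simp
    then show ?thesis unfolding soliton_def using rate_pos by (simp add: divide_right_mono)
  qed
  have cs: "continuous_on A (\<lambda>x. soliton x - soliton L)" for A
    by (intro continuous_intros continuous_on_soliton)
  define J where "J = (LINT x:{- L..L}|lborel. \<bar>soliton x - soliton L\<bar> powr p)"
  have Ji: "set_integrable lborel {-L..L} (\<lambda>x. \<bar>soliton x - soliton L\<bar> powr p)"
    using p by (intro borel_integrable_atLeastAtMost' continuous_on_powr' continuous_intros cs) auto
  have jJ: "j n \<le> J"
  proof -
    have ci: "set_integrable lborel {-L..L} (\<lambda>x. p * soliton L)"
      by (intro borel_integrable_atLeastAtMost' continuous_intros)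
    have "j n = (LINT x:{-L..L}|lborel. soliton x powr p) - (LINT x:{-L..L}|lborel. p * soliton L)"
      using L by (simp add: j_def soliton_mass_def L_def set_lebesgue_integral_def)
    also have "\<dots> = (LINT x:{-L..L}|lborel. soliton x powr p - p * soliton L)"
      by (intro set_integral_diff(2)[symmetric] set_integrable_soliton ci)
    also have "\<dots> \<le> J"
      unfolding J_def
    proof (intro set_integral_mono set_integral_diff(1) set_integrable_soliton ci Ji)
      fix x assume "x \<in> {-L..L}"
      then show "soliton x powr p - p * soliton L \<le> \<bar>soliton x - soliton L\<bar> powr p"
        using powr_diff_bound[of "soliton L" "soliton x"] sL[of x] soliton_pos[of L] soliton_le_1[of x] by simp
    qed
    finally show ?thesis .
  qed
  have E: "(LINT x:{- L..L}|lborel. (tanh (rate * x) * soliton x)\<^sup>2 + (soliton x - soliton L)\<^sup>2) \<le> e n"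
  proof -
    have "e n = (LINT x:{-L..L}|lborel. 2 * (tanh (rate * x) * soliton x)\<^sup>2 + soliton x powr p)"
      unfolding e_def soliton_mass_def kinetic_def L_def[symmetric]
      by (subst set_integral_add(2)) (use set_integrable_soliton in auto)
    moreover have "(LINT x:{- L..L}|lborel. (tanh (rate * x) * soliton x)\<^sup>2 + (soliton x - soliton L)\<^sup>2) \<le>
        (LINT x:{-L..L}|lborel. 2 * (tanh (rate * x) * soliton x)\<^sup>2 + soliton x powr p)"
    proof (rule set_integral_mono)
      show "set_integrable lborel {- L..L} (\<lambda>x. (tanh (rate * x) * soliton x)\<^sup>2 + (soliton x - soliton L)\<^sup>2)"
        by (intro borel_integrable_atLeastAtMost' continuous_intros cs continuous_on_tanh_rate continuous_on_soliton)
      show "set_integrable lborel {- L..L} (\<lambda>x. 2 * (tanh (rate * x) * soliton x)\<^sup>2 + soliton x powr p)"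
        using set_integrable_soliton by (intro set_integral_add) auto
      fix x assume "x \<in> {-L..L}"
      then have "(soliton x - soliton L)\<^sup>2 \<le> (soliton x)\<^sup>2"
        using sL[of x] soliton_pos[of L] by (intro power_mono) auto
      then show "(tanh (rate * x) * soliton x)\<^sup>2 + (soliton x - soliton L)\<^sup>2 \<le> 2 * (tanh (rate * x) * soliton x)\<^sup>2 + soliton x powr p"
        by (simp add: soliton_powr algebra_simps power_mult_distrib)
    qed
    ultimately show ?thesis by simp
  qed
  have "e n < K * j n powr (2 / p)" using n by (simp add: field_simps)
  also have "\<dots> \<le> K * J powr (2 / p)"
    using jJ n p assms gns_const_pos by (intro mult_left_mono powr_mono2) auto
  finally show ?thesis using that[of L] E L n jJ unfolding J_def by auto
qed

end

section \<open>Lower bounds along paths\<close>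

text \<open>Only values along sequences approaching the two ends matter, so segments, half-lines and the
  whole line are treated alike: at infinity, \<open>L\<^sup>2\<close> functions take arbitrarily small values.\<close>

definition ends :: "real set \<Rightarrow> (real \<Rightarrow> real) \<Rightarrow> real \<Rightarrow> real \<Rightarrow> bool" where
  "ends I f A B \<longleftrightarrow> (\<forall>x\<in>I. \<forall>e>0. \<exists>a\<in>I. \<exists>b\<in>I. a < x \<and> x < b \<and> \<bar>f a - A\<bar> < e \<and> \<bar>f b - B\<bar> < e)"

lemma L2_on_measurable:
  "f \<in> L2_on I \<Longrightarrow> (\<lambda>x. indicator I x * f x) \<in> borel_measurable borel"
  by (simp add: L2_on_def set_borel_measurable_def)

lemma L2_on_square_integrable:
  "f \<in> L2_on I \<Longrightarrow> integrable lborel (\<lambda>x. (indicator I x * f x)\<^sup>2)"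
proof -
  have "(indicator I x * f x)\<^sup>2 = indicator I x *\<^sub>R (f x)\<^sup>2" for x :: real by (simp add: indicator_def)
  then show "f \<in> L2_on I \<Longrightarrow> ?thesis" by (simp add: L2_on_def set_integrable_def)
qed

text \<open>|h (f) g| <= C (f^2 + g^2). The bound also forces h 0 = 0, so extending \<open>f\<close>
  by 0 outside \<open>I\<close> commutes with applying \<open>h\<close>.\<close>

lemma L2_on_product_integrable:
  assumes f: "f \<in> L2_on I" and g: "g \<in> L2_on I" and h: "h \<in> borel_measurable borel"
    and hC: "\<And>s. \<bar>h s\<bar> \<le> C * \<bar>s\<bar>"
  shows "set_integrable lborel I (\<lambda>x. h (f x) * \<bar>g x\<bar>)"
proof -
  define F where "F x = indicator I x * f x" for x
  define G where "G x = indicator I x * g x" for x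
  note [measurable] = L2_on_measurable[OF f, folded F_def] L2_on_measurable[OF g, folded G_def] h
  have C: "C \<ge> 0" using hC[of 1] by simp
  have h0: "h 0 = 0" using hC[of 0] by simp
  have eq: "indicator I x *\<^sub>R (h (f x) * \<bar>g x\<bar>) = h (F x) * \<bar>G x\<bar>" for x
    by (cases "x \<in> I") (auto simp: F_def G_def h0)
  have "integrable lborel (\<lambda>x. C * ((F x)\<^sup>2 + (G x)\<^sup>2))"
    using L2_on_square_integrable[OF f] L2_on_square_integrable[OF g] by (auto simp: F_def G_def)
  then show ?thesis
    unfolding set_integrable_def eq
  proof (rule Bochner_Integration.integrable_bound)
    have "\<bar>h s\<bar> * \<bar>t\<bar> \<le> C * (s\<^sup>2 + t\<^sup>2)" for s t
    proof -
      have "\<bar>h s\<bar> * \<bar>t\<bar> \<le> C * \<bar>s\<bar> * \<bar>t\<bar>" by (intro mult_right_mono hC) simp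
      also have "\<dots> \<le> C * (s\<^sup>2 + t\<^sup>2)"
      proof -
        have "2 * (\<bar>s\<bar> * \<bar>t\<bar>) \<le> s\<^sup>2 + t\<^sup>2"
          using sum_squares_bound[of "\<bar>s\<bar>" "\<bar>t\<bar>"] by (simp add: mult.assoc)
        moreover have "\<bar>s\<bar> * \<bar>t\<bar> \<ge> 0" by simp
        ultimately have "\<bar>s\<bar> * \<bar>t\<bar> \<le> s\<^sup>2 + t\<^sup>2" by linarith
        then show ?thesis using C by (simp add: mult.assoc mult_left_mono)
      qed
      finally show ?thesis .
    qed
    then show "AE x in lborel. norm (h (F x) * \<bar>G x\<bar>) \<le> norm (C * ((F x)\<^sup>2 + (G x)\<^sup>2))"
      using C by (simp add: abs_mult)
  qed measurable
qed

text \<open>The chain rule applies on compact pieces on the two sides of \<open>x\<close>, whose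
  integrals add up to at most the integral over \<open>I\<close>. The outer end points then run
  along sequences on which \<open>f\<close> tends to \<open>A\<close> and to
  \<open>B\<close>.\<close>

lemma path_bound:
  assumes ac: "ac_pair I f g" and xI: "x \<in> I" and ends: "ends I f A B"
    and H: "\<And>s. (H has_real_derivative h s) (at s)" and h: "continuous_on UNIV h"
    and hC: "\<And>s. \<bar>h s\<bar> \<le> C * \<bar>s\<bar>"
  shows "\<bar>H (f x) - H A\<bar> + \<bar>H B - H (f x)\<bar> \<le> (LINT t:I|lborel. \<bar>h (f t)\<bar> * \<bar>g t\<bar>)"
proof -
  define V where "V S = (LINT t:S|lborel. \<bar>h (f t)\<bar> * \<bar>g t\<bar>)" for S
  have I: "open I" "is_interval I" and cf: "continuous_on I f" and L: "f \<in> L2_on I" "g \<in> L2_on I"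
    using ac by (auto simp: ac_pair_def)
  have "h \<in> borel_measurable borel" by (rule borel_measurable_continuous_onI[OF h])
  then have "set_integrable lborel I (\<lambda>t. \<bar>h (f t)\<bar> * \<bar>g t\<bar>)"
    using hC by (intro L2_on_product_integrable[OF L, where C = C]) auto
  then have si: "set_integrable lborel S (\<lambda>t. \<bar>h (f t)\<bar> * \<bar>g t\<bar>)" if "S \<subseteq> I" "S \<in> sets borel" for S
    by (rule set_integrable_subset) (use that in auto)
  have chain: "\<bar>H (f b) - H (f a)\<bar> \<le> V {a..b}" if "a \<in> I" "b \<in> I" "a \<le> b" for a b
  proof -
    have sub: "{a..b} \<subseteq> I" using is_interval_Icc_subset[OF I(2)] that by auto
    show ?thesis
      unfolding V_def
    proof (rule chain_rule_bound[OF that(3) continuous_on_subset[OF cf sub] L2_on_set_integrable[OF L(2) sub] _ H h])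
      fix x y assume "a \<le> x" "x \<le> y" "y \<le> b"
      then have "x \<in> I" "y \<in> I" using sub by auto
      then show "f y - f x = (LINT t:{x..y}|lborel. g t)" using ac \<open>x \<le> y\<close> by (auto simp: ac_pair_def)
    qed
  qed
  have main: "\<bar>H (f x) - H (f a)\<bar> + \<bar>H (f b) - H (f x)\<bar> \<le> V I" if "a \<in> I" "b \<in> I" "a < x" "x < b" for a b
  proof -
    have sub: "{a..x} \<subseteq> I" "{x..b} \<subseteq> I" using is_interval_Icc_subset[OF I(2)] that xI by auto
    have "\<bar>H (f x) - H (f a)\<bar> + \<bar>H (f b) - H (f x)\<bar> \<le> V {a..x} + V {x..b}"
      using chain[of a x] chain[of x b] that xI by auto
    also have "\<dots> = V ({a..x} \<union> {x..b})"
      unfolding V_def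
      by (rule set_integral_Un_AE[symmetric])
        (use si sub AE_lborel_singleton[of x] in \<open>auto elim!: eventually_mono\<close>)
    also have "\<dots> \<le> V I"
      unfolding V_def set_lebesgue_integral_def
    proof (rule integral_mono)
      show "integrable lborel (\<lambda>t. indicator ({a..x} \<union> {x..b}) t *\<^sub>R (\<bar>h (f t)\<bar> * \<bar>g t\<bar>))"
        using si[of "{a..x} \<union> {x..b}"] sub by (auto simp: set_integrable_def)
      show "integrable lborel (\<lambda>t. indicator I t *\<^sub>R (\<bar>h (f t)\<bar> * \<bar>g t\<bar>))"
        using si[of I] I(1) by (auto simp: set_integrable_def)
      fix t
      have "indicator ({a..x} \<union> {x..b}) t \<le> (indicator I t :: real)"
        by (rule indicator_leI) (use sub in blast)
      then show "indicator ({a..x} \<union> {x..b}) t *\<^sub>R (\<bar>h (f t)\<bar> * \<bar>g t\<bar>) \<le> indicator I t *\<^sub>R (\<bar>h (f t)\<bar> * \<bar>g t\<bar>)"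
        unfolding real_scaleR_def by (rule mult_right_mono) simp
    qed
    finally show ?thesis .
  qed
  have "\<forall>n. \<exists>ab. fst ab \<in> I \<and> snd ab \<in> I \<and> fst ab < x \<and> x < snd ab \<and>
      \<bar>f (fst ab) - A\<bar> < inverse (real (Suc n)) \<and> \<bar>f (snd ab) - B\<bar> < inverse (real (Suc n))"
    using ends xI unfolding ends_def by (metis fst_conv snd_conv inverse_positive_iff_positive of_nat_0_less_iff zero_less_Suc)
  then obtain ab where ab: "\<And>n. fst (ab n) \<in> I \<and> snd (ab n) \<in> I \<and> fst (ab n) < x \<and> x < snd (ab n) \<and>
      \<bar>f (fst (ab n)) - A\<bar> < inverse (real (Suc n)) \<and> \<bar>f (snd (ab n)) - B\<bar> < inverse (real (Suc n))"
    by metis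
  have lim: "(\<lambda>n. u n) \<longlonglongrightarrow> D" if "\<And>n. \<bar>u n - D\<bar> < inverse (real (Suc n))" for u and D :: real
  proof (rule LIM_zero_cancel, rule Lim_null_comparison[OF _ LIMSEQ_inverse_real_of_nat])
    show "\<forall>\<^sub>F n in sequentially. norm (u n - D) \<le> inverse (real (Suc n))"
      using that by (intro always_eventually allI) (auto simp: less_imp_le)
  qed
  have Hc: "isCont H s" for s using H DERIV_isCont by blast
  have "(\<lambda>n. \<bar>H (f x) - H (f (fst (ab n)))\<bar> + \<bar>H (f (snd (ab n))) - H (f x)\<bar>) \<longlonglongrightarrow>
      \<bar>H (f x) - H A\<bar> + \<bar>H B - H (f x)\<bar>"
    by (intro tendsto_intros isCont_tendsto_compose[OF Hc] lim) (use ab in auto)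
  then show ?thesis
    unfolding V_def[symmetric] by (rule LIMSEQ_le_const2) (use main ab in blast)
qed

text \<open>The path bound with H s = s^2: f^2 exceeds its limit A^2 by at most the integral of |2 f
  g|, which does not depend on the point.\<close>

lemma ac_pair_bounded:
  assumes ac: "ac_pair I f g" and ends: "ends I f A B"
  shows "\<exists>M. \<forall>x\<in>I. \<bar>f x\<bar> \<le> M"
proof -
  define V where "V = (LINT t:I|lborel. \<bar>2 * f t\<bar> * \<bar>g t\<bar>)"
  have "(f x)\<^sup>2 \<le> (1 + (A\<^sup>2 + V))\<^sup>2" if "x \<in> I" for x
  proof -
    have "\<bar>(f x)\<^sup>2 - A\<^sup>2\<bar> + \<bar>B\<^sup>2 - (f x)\<^sup>2\<bar> \<le> V"
      unfolding V_def
      by (rule path_bound[OF ac that ends, where H = "\<lambda>s. s\<^sup>2" and C = 2])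
        (auto intro!: derivative_eq_intros continuous_intros)
    then have 1: "(f x)\<^sup>2 \<le> A\<^sup>2 + V" by linarith
    moreover have "0 \<le> A\<^sup>2 + V" using 1 zero_le_power2[of "f x"] by linarith
    moreover have "c \<le> (1 + c)\<^sup>2" if "0 \<le> c" for c :: real
      using that zero_le_power2[of c] by (simp add: power2_sum)
    ultimately show ?thesis by (meson order_trans)
  qed
  then have "\<bar>f x\<bar> \<le> \<bar>1 + (A\<^sup>2 + V)\<bar>" if "x \<in> I" for x
    using that abs_le_square_iff by blast
  then show ?thesis by blast
qed

text \<open>Gronwall's argument: |f'| <= |f| makes ln (f^2) Lipschitz with constant 2. Zeros of
  \<open>f\<close> are avoided by taking ln (d + f^2) with d > 0 and letting d tend to 0 after
  exponentiating.\<close>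

lemma exponential_growth_bound:
  assumes ac: "ac_pair I f g" and le: "AE t in lborel. t \<in> I \<longrightarrow> \<bar>g t\<bar> \<le> \<bar>f t\<bar>"
    and xy: "x \<in> I" "y \<in> I"
  shows "(f y)\<^sup>2 \<le> exp (2 * \<bar>y - x\<bar>) * (f x)\<^sup>2"
proof -
  have I: "open I" "is_interval I" and cf: "continuous_on I f" and L: "f \<in> L2_on I" "g \<in> L2_on I"
    using ac by (auto simp: ac_pair_def)
  have log: "\<bar>ln (d + (f b)\<^sup>2) - ln (d + (f a)\<^sup>2)\<bar> \<le> 2 * (b - a)"
    if ab: "a \<in> I" "b \<in> I" "a \<le> b" and d: "d > 0" for a b d
  proof -
    have sub: "{a..b} \<subseteq> I" using is_interval_Icc_subset[OF I(2)] ab by auto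
    define h where "h s = 2 * s / (d + s\<^sup>2)" for s
    have pos: "d + s\<^sup>2 > 0" for s using d by (simp add: add_pos_nonneg)
    have D: "((\<lambda>s. ln (d + s\<^sup>2)) has_real_derivative h s) (at s)" for s
      using pos[of s] unfolding h_def by (auto intro!: derivative_eq_intros)
    have ch: "continuous_on UNIV h"
      unfolding h_def using pos by (intro continuous_intros) (auto simp: less_imp_neq[symmetric])
    have "\<bar>ln (d + (f b)\<^sup>2) - ln (d + (f a)\<^sup>2)\<bar> \<le> (LINT t:{a..b}|lborel. \<bar>h (f t)\<bar> * \<bar>g t\<bar>)"
    proof (rule chain_rule_bound[OF ab(3) continuous_on_subset[OF cf sub] L2_on_set_integrable[OF L(2) sub] _ D ch])
      fix x y assume "a \<le> x" "x \<le> y" "y \<le> b"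
      then have "x \<in> I" "y \<in> I" using sub by auto
      then show "f y - f x = (LINT t:{x..y}|lborel. g t)" using ac \<open>x \<le> y\<close> by (auto simp: ac_pair_def)
    qed
    also have "\<dots> \<le> (LINT t:{a..b}|lborel. 2)"
    proof (rule set_integral_mono_AE)
      have "\<bar>h s\<bar> \<le> (2 / d) * \<bar>s\<bar>" for s
      proof -
        have "\<bar>h s\<bar> = (2 * \<bar>s\<bar>) / (d + s\<^sup>2)" using pos[of s] by (simp add: h_def abs_mult)
        also have "\<dots> \<le> (2 * \<bar>s\<bar>) / d" using d by (intro divide_left_mono) (auto simp: add_pos_nonneg)
        finally show ?thesis by simp
      qed
      then have "set_integrable lborel I (\<lambda>t. \<bar>h (f t)\<bar> * \<bar>g t\<bar>)"
        by (intro L2_on_product_integrable[OF L, where C = "2 / d"])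
          (auto intro: borel_measurable_continuous_onI[OF ch] borel_measurable_abs)
      then show "set_integrable lborel {a..b} (\<lambda>t. \<bar>h (f t)\<bar> * \<bar>g t\<bar>)"
        by (rule set_integrable_subset) (use sub in auto)
      show "set_integrable lborel {a..b} (\<lambda>t. 2 :: real)"
        by (intro borel_integrable_atLeastAtMost' continuous_intros)
      show "AE t\<in>{a..b} in lborel. \<bar>h (f t)\<bar> * \<bar>g t\<bar> \<le> 2"
        using le
      proof eventually_elim
        case (elim t)
        show ?case
        proof
          assume "t \<in> {a..b}"
          then have "\<bar>g t\<bar> \<le> \<bar>f t\<bar>" using elim sub by auto
          then have "\<bar>h (f t)\<bar> * \<bar>g t\<bar> \<le> \<bar>h (f t)\<bar> * \<bar>f t\<bar>" by (intro mult_left_mono) auto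
          also have "\<dots> = 2 * (f t)\<^sup>2 / (d + (f t)\<^sup>2)"
            using pos[of "f t"] by (simp add: h_def abs_mult power2_eq_square)
          also have "\<dots> \<le> 2" using pos[of "f t"] d by (simp add: divide_le_eq)
          finally show "\<bar>h (f t)\<bar> * \<bar>g t\<bar> \<le> 2" .
        qed
      qed
    qed
    also have "\<dots> = 2 * (b - a)" using ab by (simp add: set_lebesgue_integral_def)
    finally show ?thesis .
  qed
  have "(f y)\<^sup>2 \<le> exp (2 * \<bar>y - x\<bar>) * (d + (f x)\<^sup>2)" if d: "d > 0" for d
  proof -
    have pos: "d + s\<^sup>2 > 0" for s :: real using d by (simp add: add_pos_nonneg)
    have "ln (d + (f y)\<^sup>2) \<le> 2 * \<bar>y - x\<bar> + ln (d + (f x)\<^sup>2)"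
      using log[OF xy _ d] log[OF xy(2,1) _ d] by (cases "x \<le> y") auto
    then have "exp (ln (d + (f y)\<^sup>2)) \<le> exp (2 * \<bar>y - x\<bar> + ln (d + (f x)\<^sup>2))" by simp
    then show ?thesis using pos d by (simp add: exp_add)
  qed
  then show ?thesis
    by (intro tendsto_lowerbound[of "\<lambda>d. exp (2 * \<bar>y - x\<bar>) * (d + (f x)\<^sup>2)" _ "at_right 0"])
      (auto simp: eventually_at_filter intro!: tendsto_eq_intros)
qed

lemma set_integral_pos:
  fixes k :: "real \<Rightarrow> real"
  assumes I: "open I" "x \<in> I" and k: "continuous_on I k" "\<And>t. t \<in> I \<Longrightarrow> k t \<ge> 0" "k x > 0"
    and si: "set_integrable lborel I k"
  shows "(LINT t:I|lborel. k t) > 0"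
proof -
  have "isCont k x" using I k(1) continuous_on_eq_continuous_at by blast
  then have "\<forall>\<^sub>F t in nhds x. k t > k x / 2"
    using k(3) by (intro order_tendstoD(1)[of k "k x"])
      (auto simp: isCont_def tendsto_at_iff_tendsto_nhds)
  then have "\<forall>\<^sub>F t in nhds x. k t > k x / 2 \<and> t \<in> I"
    using eventually_nhds_in_open[OF I] by eventually_elim auto
  then obtain e where e: "e > 0" "\<And>t. dist t x < e \<Longrightarrow> k t > k x / 2 \<and> t \<in> I"
    unfolding eventually_nhds_metric by auto
  have "0 < e * (k x / 2)" using e k by simp
  also have "\<dots> = (LINT t:{x - e / 2..x + e / 2}|lborel. k x / 2)" using e by (simp add: set_lebesgue_integral_def)
  also have "\<dots> \<le> (LINT t:I|lborel. k t)"
    unfolding set_lebesgue_integral_def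
  proof (rule integral_mono)
    show "integrable lborel (\<lambda>t. indicator {x - e / 2..x + e / 2} t *\<^sub>R (k x / 2))"
      using borel_integrable_atLeastAtMost'[of "x - e/2" "x + e/2" "\<lambda>t. k x / 2"] by (simp add: set_integrable_def)
    show "integrable lborel (\<lambda>t. indicator I t *\<^sub>R k t)" using si by (simp add: set_integrable_def)
    fix t
    show "indicator {x - e / 2..x + e / 2} t *\<^sub>R (k x / 2) \<le> indicator I t *\<^sub>R k t"
    proof (cases "t \<in> {x - e / 2..x + e / 2}")
      case True
      then have "dist t x < e" using e(1) by (auto simp: dist_real_def)
      then show ?thesis using e(2)[of t] True by simp
    next
      case False
      then show ?thesis using k(2)[of t] by (cases "t \<in> I") auto
    qed
  qed
  finally show ?thesis .
qed

lemma L2_on_scale: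
  assumes "f \<in> L2_on I" shows "(\<lambda>x. c * f x) \<in> L2_on I"
proof -
  have m: "(\<lambda>x. indicator I x * f x) \<in> borel_measurable borel" by (rule L2_on_measurable[OF assms])
  have "(\<lambda>x. c * (indicator I x * f x)) \<in> borel_measurable borel" using m by measurable
  moreover have "set_integrable lborel I (\<lambda>x. c\<^sup>2 * (f x)\<^sup>2)"
    using assms by (auto simp: L2_on_def)
  ultimately show ?thesis
    by (simp add: L2_on_def set_borel_measurable_def power_mult_distrib mult_ac)
qed

lemma ac_pair_scale:
  assumes "ac_pair I f g" shows "ac_pair I (\<lambda>x. c * f x) (\<lambda>x. c * g x)"
  using assms unfolding ac_pair_def
  by (auto simp: L2_on_scale right_diff_distrib[symmetric] intro!: continuous_intros)

lemma ends_scale: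
  assumes "ends I f A B" "c > 0" shows "ends I (\<lambda>x. c * f x) (c * A) (c * B)"
  unfolding ends_def
proof (intro ballI allI impI)
  fix x e :: real assume "x \<in> I" "e > 0"
  then have "e / c > 0" using assms(2) by simp
  then obtain a b where "a \<in> I" "b \<in> I" "a < x" "x < b" "\<bar>f a - A\<bar> < e / c" "\<bar>f b - B\<bar> < e / c"
    using assms(1) \<open>x \<in> I\<close> unfolding ends_def by blast
  moreover have "\<bar>c * s - c * t\<bar> < e" if "\<bar>s - t\<bar> < e / c" for s t
    using that assms(2) by (simp add: right_diff_distrib[symmetric] abs_mult pos_less_divide_eq mult.commute)
  ultimately show "\<exists>a\<in>I. \<exists>b\<in>I. a < x \<and> x < b \<and> \<bar>c * f a - c * A\<bar> < e \<and> \<bar>c * f b - c * B\<bar> < e"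
    by blast
qed

lemma sum_remove_bound:
  fixes v :: "'a \<Rightarrow> real"
  assumes "finite S" "e \<in> S" "\<And>i. i \<in> S \<Longrightarrow> b \<le> v i"
  shows "v e + (real (card S) - 1) * b \<le> (\<Sum>i\<in>S. v i)"
proof -
  have "card S \<ge> 1" using assms by (simp add: Suc_le_eq card_gt_0_iff) blast
  then have "(real (card S) - 1) * b = (\<Sum>i\<in>S - {e}. b)"
    using assms by (simp add: card_Diff_singleton of_nat_diff)
  also have "\<dots> \<le> (\<Sum>i\<in>S - {e}. v i)" by (rule sum_mono) (use assms in auto)
  finally show ?thesis using sum.remove[OF assms(1,2), of v] by simp
qed

section \<open>The sharp inequality on a finite network\<close>

context gns_exponent
begin

text \<open>The second part is the inclusion of bounded L^2 functions in L^p: |f|^p <= M^(p-2)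
  f^2.\<close>

lemma integrands_integrable:
  assumes ac: "ac_pair I f g" and le: "\<And>x. x \<in> I \<Longrightarrow> \<bar>f x\<bar> \<le> M" and M: "M > 0"
  shows "set_integrable lborel I (\<lambda>x. (g x)\<^sup>2 + (f x)\<^sup>2)"
    and "set_integrable lborel I (\<lambda>x. \<bar>f x\<bar> powr p)"
    and "set_integrable lborel I (\<lambda>x. slope (f x) * \<bar>g x\<bar>)"
proof -
  have L: "f \<in> L2_on I" "g \<in> L2_on I" using ac by (auto simp: ac_pair_def)
  show "set_integrable lborel I (\<lambda>x. (g x)\<^sup>2 + (f x)\<^sup>2)"
    using L by (intro set_integral_add) (auto simp: L2_on_def)
  show "set_integrable lborel I (\<lambda>x. slope (f x) * \<bar>g x\<bar>)"
    by (rule L2_on_product_integrable[OF L, where C = 2])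
      (use slope_le slope_nonneg in \<open>auto intro: borel_measurable_continuous_onI[OF continuous_slope]\<close>)
  define F where "F x = indicator I x * f x" for x
  note [measurable] = L2_on_measurable[OF L(1), folded F_def]
  have F: "\<bar>F x\<bar> \<le> M" for x using le[of x] M by (cases "x \<in> I") (auto simp: F_def)
  have "integrable lborel (\<lambda>x. \<bar>F x\<bar> powr p)"
  proof (rule Bochner_Integration.integrable_bound)
    show "integrable lborel (\<lambda>x. M powr (p - 2) * (F x)\<^sup>2)"
      using L2_on_square_integrable[OF L(1)] by (simp add: F_def)
    have "\<bar>F x\<bar> powr p \<le> M powr (p - 2) * (F x)\<^sup>2" for x
    proof (cases "F x = 0")
      case False
      have "\<bar>F x\<bar> powr p = \<bar>F x\<bar> powr (p - 2) * \<bar>F x\<bar> powr 2"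
        using powr_add[of "\<bar>F x\<bar>" "p - 2" 2] by simp
      also have "\<dots> \<le> M powr (p - 2) * \<bar>F x\<bar> powr 2"
        using p F by (intro mult_right_mono powr_mono2) auto
      finally show ?thesis using False by simp
    qed (use p in simp)
    then show "AE x in lborel. norm (\<bar>F x\<bar> powr p) \<le> norm (M powr (p - 2) * (F x)\<^sup>2)" by simp
  qed measurable
  moreover have "\<bar>F x\<bar> powr p = indicator I x *\<^sub>R (\<bar>f x\<bar> powr p)" for x
    using p by (cases "x \<in> I") (auto simp: F_def)
  ultimately show "set_integrable lborel I (\<lambda>x. \<bar>f x\<bar> powr p)" by (simp add: set_integrable_def)
qed

text \<open>The square left over on completing the square: a nonnegative surplus that has to vanish
  in the case of equality.\<close>

definition defect :: "real set \<Rightarrow> (real \<Rightarrow> real) \<Rightarrow> (real \<Rightarrow> real) \<Rightarrow> real" where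
  "defect I f g = (LINT x:I|lborel. (\<bar>g x\<bar> - slope (f x) / 2)\<^sup>2)"

text \<open>If the integral of the square is 0, then |g| = slope f / 2 almost everywhere, and
  \<open>slope_le\<close> gives the hypothesis of the Gronwall argument.\<close>

lemma energy_splitting:
  assumes ac: "ac_pair I f g" and le: "\<And>x. x \<in> I \<Longrightarrow> \<bar>f x\<bar> \<le> 1"
  shows "(LINT x:I|lborel. (g x)\<^sup>2 + (f x)\<^sup>2) =
      (LINT x:I|lborel. \<bar>f x\<bar> powr p) + defect I f g + (LINT x:I|lborel. slope (f x) * \<bar>g x\<bar>)"
    and "defect I f g \<ge> 0"
    and "defect I f g = 0 \<Longrightarrow> AE x in lborel. x \<in> I \<longrightarrow> \<bar>g x\<bar> \<le> \<bar>f x\<bar>"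
proof -
  note int = integrands_integrable[OF ac le, simplified]
  have sq: "(g x)\<^sup>2 + (f x)\<^sup>2 - \<bar>f x\<bar> powr p - slope (f x) * \<bar>g x\<bar> = (\<bar>g x\<bar> - slope (f x) / 2)\<^sup>2" if "x \<in> I" for x
    using completing_the_square[OF le[OF that], of "g x"] by linarith
  have "I \<in> sets borel" using ac by (auto simp: ac_pair_def)
  then have eq: "defect I f g = (LINT x:I|lborel. (g x)\<^sup>2 + (f x)\<^sup>2 - \<bar>f x\<bar> powr p - slope (f x) * \<bar>g x\<bar>)"
    unfolding defect_def by (intro set_lebesgue_integral_cong) (auto simp: sq)
  show "(LINT x:I|lborel. (g x)\<^sup>2 + (f x)\<^sup>2) =
      (LINT x:I|lborel. \<bar>f x\<bar> powr p) + defect I f g + (LINT x:I|lborel. slope (f x) * \<bar>g x\<bar>)"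
    unfolding eq using int by (simp add: set_integral_diff)
  show "defect I f g \<ge> 0"
    unfolding defect_def set_lebesgue_integral_def by (intro Bochner_Integration.integral_nonneg) simp
  assume z: "defect I f g = 0"
  have "set_integrable lborel I (\<lambda>x. (g x)\<^sup>2 + (f x)\<^sup>2 - \<bar>f x\<bar> powr p - slope (f x) * \<bar>g x\<bar>)"
    using int by (intro set_integral_diff(1))
  then have "set_integrable lborel I (\<lambda>x. (\<bar>g x\<bar> - slope (f x) / 2)\<^sup>2)"
    by (subst set_integrable_cong[OF refl refl sq[symmetric]]) auto
  then have "AE x in lborel. indicator I x *\<^sub>R (\<bar>g x\<bar> - slope (f x) / 2)\<^sup>2 = 0"
    using z integral_nonneg_eq_0_iff_AE[of lborel "\<lambda>x. indicator I x *\<^sub>R (\<bar>g x\<bar> - slope (f x) / 2)\<^sup>2"]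
    by (simp add: defect_def set_lebesgue_integral_def set_integrable_def)
  then show "AE x in lborel. x \<in> I \<longrightarrow> \<bar>g x\<bar> \<le> \<bar>f x\<bar>"
  proof eventually_elim
    case (elim x)
    then show ?case using slope_le[of "f x"] by auto
  qed
qed

text \<open>The surplus terms \<open>defect\<close> and (card S - 2) pot |c| are kept in the
  inequality so that the equality case can be read off from it.\<close>

lemma normalised_bound:
  fixes S :: "'e set"
  assumes S: "finite S" and ac: "\<And>e. e \<in> S \<Longrightarrow> ac_pair (I e) (f e) (g e)"
    and ends: "\<And>e. e \<in> S \<Longrightarrow> ends (I e) (f e) c 0 \<or> ends (I e) (f e) 0 c"
    and ne: "\<And>e. e \<in> S \<Longrightarrow> I e \<noteq> {}"
    and le: "\<And>e x. e \<in> S \<Longrightarrow> x \<in> I e \<Longrightarrow> \<bar>f e x\<bar> \<le> 1"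
    and sup: "\<And>\<eta>. \<eta> > 0 \<Longrightarrow> \<exists>e\<in>S. \<exists>x\<in>I e. \<bar>f e x\<bar> > 1 - \<eta>"
  shows "(\<Sum>e\<in>S. LINT x:I e|lborel. \<bar>f e x\<bar> powr p) + (\<Sum>e\<in>S. defect (I e) (f e) (g e))
      + 2 * pot 1 + (real (card S) - 2) * pot \<bar>c\<bar>
      \<le> (\<Sum>e\<in>S. LINT x:I e|lborel. (g e x)\<^sup>2 + (f e x)\<^sup>2)"
proof -
  define V where "V e = (LINT x:I e|lborel. slope (f e x) * \<bar>g e x\<bar>)" for e
  have split: "(\<Sum>e\<in>S. LINT x:I e|lborel. (g e x)\<^sup>2 + (f e x)\<^sup>2) =
      (\<Sum>e\<in>S. LINT x:I e|lborel. \<bar>f e x\<bar> powr p) + (\<Sum>e\<in>S. defect (I e) (f e) (g e)) + (\<Sum>e\<in>S. V e)"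
    unfolding V_def sum.distrib[symmetric]
    by (rule sum.cong[OF refl]) (rule energy_splitting(1)[OF ac le])
  \<comment> \<open>The bound is symmetric in the two ends, so the orientation of an edge does not
    matter here; pot 0 = 0 simplifies the term for the far end.\<close>
  have path: "\<bar>pot (f e x) - pot c\<bar> + \<bar>pot (f e x)\<bar> \<le> V e" if "e \<in> S" "x \<in> I e" for e x
  proof -
    have "\<bar>pot (f e x) - pot A\<bar> + \<bar>pot B - pot (f e x)\<bar> \<le> V e" if "ends (I e) (f e) A B" for A B
      using path_bound[OF ac[OF \<open>e \<in> S\<close>] \<open>x \<in> I e\<close> that DERIV_pot continuous_slope, of 2] slope_le slope_nonneg
      by (simp add: V_def)
    from this[of c 0] this[of 0 c] ends[OF that(1)] show ?thesis by auto
  qed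
  have edge: "\<bar>pot c\<bar> \<le> V e" if e: "e \<in> S" for e
  proof -
    obtain x where "x \<in> I e" using ne[OF e] by blast
    from path[OF e this] show ?thesis by linarith
  qed
  have main: "2 * pot \<bar>f e x\<bar> + (real (card S) - 2) * pot \<bar>c\<bar> \<le> (\<Sum>e\<in>S. V e)" if "e \<in> S" "x \<in> I e" for e x
  proof -
    have "V e + (real (card S) - 1) * \<bar>pot c\<bar> \<le> (\<Sum>e\<in>S. V e)"
      by (rule sum_remove_bound[OF S that(1) edge])
    \<comment> \<open>Triangle inequality for the way from x to P.\<close>
    moreover have "2 * \<bar>pot (f e x)\<bar> - \<bar>pot c\<bar> \<le> V e" using path[OF that] by linarith
    ultimately show ?thesis by (simp add: abs_pot algebra_simps)
  qed
  have "2 * pot (1 - inverse (real (Suc n))) + (real (card S) - 2) * pot \<bar>c\<bar> \<le> (\<Sum>e\<in>S. V e)" for n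
  proof -
    obtain e x where ex: "e \<in> S" "x \<in> I e" "\<bar>f e x\<bar> > 1 - inverse (real (Suc n))"
      using sup[of "inverse (real (Suc n))"] by auto
    then have "pot (1 - inverse (real (Suc n))) \<le> pot \<bar>f e x\<bar>" by (intro pot_mono) simp
    with main[OF ex(1,2)] show ?thesis by linarith
  qed
  moreover have "(\<lambda>n. 2 * pot (1 - inverse (real (Suc n))) + (real (card S) - 2) * pot \<bar>c\<bar>) \<longlonglongrightarrow>
      2 * pot (1 - 0) + (real (card S) - 2) * pot \<bar>c\<bar>"
    by (intro tendsto_intros isCont_tendsto_compose[OF isCont_pot] LIMSEQ_inverse_real_of_nat)
  ultimately have "2 * pot 1 + (real (card S) - 2) * pot \<bar>c\<bar> \<le> (\<Sum>e\<in>S. V e)"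
    using LIMSEQ_le_const2 by (metis (no_types, lifting) diff_zero)
  then show ?thesis using split by linarith
qed

text \<open>Reduction to supremum 1 by homogeneity: E scales like M^2 and J like M^p, so both sides
  of the inequality scale like M^2. The last two conclusions extract from equality that the surplus
  terms are 0.\<close>

lemma network_bound:
  fixes S :: "'e set" and I f g c
  defines "J \<equiv> \<Sum>e\<in>S. LINT x:I e|lborel. \<bar>f e x\<bar> powr p"
    and "E \<equiv> \<Sum>e\<in>S. LINT x:I e|lborel. (g e x)\<^sup>2 + (f e x)\<^sup>2"
  assumes S: "finite S" and ac: "\<And>e. e \<in> S \<Longrightarrow> ac_pair (I e) (f e) (g e)"
    and ends: "\<And>e. e \<in> S \<Longrightarrow> ends (I e) (f e) c 0 \<or> ends (I e) (f e) 0 c"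
    and ne: "\<And>e. e \<in> S \<Longrightarrow> I e \<noteq> {}"
    and card: "card S \<ge> 2 \<or> c = 0"
    and nz: "e0 \<in> S" "x0 \<in> I e0" "f e0 x0 \<noteq> 0"
  shows "J > 0" and "gns_const * J powr (2 / p) \<le> E"
    and "E = gns_const * J powr (2 / p) \<Longrightarrow> card S > 2 \<Longrightarrow> c = 0"
    and "E = gns_const * J powr (2 / p) \<Longrightarrow> e \<in> S \<Longrightarrow> x \<in> I e \<Longrightarrow> y \<in> I e \<Longrightarrow>
      (f e y)\<^sup>2 \<le> exp (2 * \<bar>y - x\<bar>) * (f e x)\<^sup>2"
proof -
  define R where "R = (\<Union>e\<in>S. (\<lambda>x. \<bar>f e x\<bar>) ` I e)"
  have "\<forall>e\<in>S. \<exists>B. \<forall>x\<in>I e. \<bar>f e x\<bar> \<le> B" using ac_pair_bounded ac ends by blast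
  then obtain B where B: "\<And>e x. e \<in> S \<Longrightarrow> x \<in> I e \<Longrightarrow> \<bar>f e x\<bar> \<le> B e" by metis
  have bdd: "bdd_above R"
    unfolding R_def using S B by (intro bdd_above_UN[THEN iffD2] ballI bdd_aboveI2) auto
  define M where "M = Sup R"
  have leM: "\<bar>f e x\<bar> \<le> M" if "e \<in> S" "x \<in> I e" for e x
    unfolding M_def by (rule cSup_upper[OF _ bdd]) (use that in \<open>auto simp: R_def\<close>)
  have M: "M > 0" using leM[OF nz(1,2)] nz(3) by linarith
  define f' where "f' e x = inverse M * f e x" for e x
  define g' where "g' e x = inverse M * g e x" for e x
  define J' where "J' = (\<Sum>e\<in>S. LINT x:I e|lborel. \<bar>f' e x\<bar> powr p)"
  define E' where "E' = (\<Sum>e\<in>S. LINT x:I e|lborel. (g' e x)\<^sup>2 + (f' e x)\<^sup>2)"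
  define D where "D = (\<Sum>e\<in>S. defect (I e) (f' e) (g' e))"
  have ac': "ac_pair (I e) (f' e) (g' e)" if "e \<in> S" for e
    unfolding f'_def[abs_def] g'_def[abs_def] by (rule ac_pair_scale[OF ac[OF that]])
  have le': "\<bar>f' e x\<bar> \<le> 1" if "e \<in> S" "x \<in> I e" for e x
    using leM[OF that] M by (simp add: f'_def abs_mult field_simps)
  have bound: "J' + D + 2 * pot 1 + (real (card S) - 2) * pot \<bar>inverse M * c\<bar> \<le> E'"
    unfolding J'_def D_def E'_def
  proof (rule normalised_bound[OF S ac' _ ne le'])
    show "ends (I e) (f' e) (inverse M * c) 0 \<or> ends (I e) (f' e) 0 (inverse M * c)" if "e \<in> S" for e
      using ends[OF that] ends_scale[of "I e" "f e" _ _ "inverse M"] M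
      unfolding f'_def[abs_def] by fastforce
    fix \<eta> :: real assume "\<eta> > 0"
    then have "M * (1 - \<eta>) < M" using M by simp
    moreover have "R \<noteq> {}" using nz by (auto simp: R_def)
    ultimately obtain r where "r \<in> R" "M * (1 - \<eta>) < r"
      using less_cSup_iff[OF _ bdd] unfolding M_def by blast
    then obtain e x where "e \<in> S" "x \<in> I e" "M * (1 - \<eta>) < \<bar>f e x\<bar>" by (auto simp: R_def)
    then show "\<exists>e\<in>S. \<exists>x\<in>I e. \<bar>f' e x\<bar> > 1 - \<eta>"
      using M by (intro bexI[of _ e] bexI[of _ x]) (auto simp: f'_def abs_mult field_simps)
  qed
  have "E' = (\<Sum>e\<in>S. (inverse M)\<^sup>2 * (LINT x:I e|lborel. (g e x)\<^sup>2 + (f e x)\<^sup>2))"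
    unfolding E'_def f'_def g'_def
    by (intro sum.cong refl, subst set_integral_mult_right[symmetric])
      (simp add: power_mult_distrib distrib_left)
  then have "E' = (inverse M)\<^sup>2 * E" by (simp only: E_def sum_distrib_left)
  then have E: "E = M\<^sup>2 * E'" using M by (simp add: field_simps)
  have "J' = (\<Sum>e\<in>S. (inverse M) powr p * (LINT x:I e|lborel. \<bar>f e x\<bar> powr p))"
    unfolding J'_def f'_def using M
    by (intro sum.cong refl, subst set_integral_mult_right[symmetric])
      (simp add: abs_mult powr_mult)
  then have "J' = (inverse M) powr p * J" by (simp only: J_def sum_distrib_left)
  moreover have "M powr p * (inverse M) powr p = 1" using M by (simp flip: powr_mult)
  ultimately have J: "J = M powr p * J'" by (simp only: mult.assoc[symmetric] mult_1_left)
  have Jpos: "(LINT x:I e|lborel. \<bar>f e x\<bar> powr p) \<ge> 0" for e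
    unfolding set_lebesgue_integral_def by (intro Bochner_Integration.integral_nonneg) simp
  have "continuous_on (I e0) (\<lambda>x. \<bar>f e0 x\<bar> powr p)"
  proof (rule continuous_on_powr')
    show "continuous_on (I e0) (\<lambda>x. \<bar>f e0 x\<bar>)"
      using ac[OF nz(1)] by (auto simp: ac_pair_def intro: continuous_on_rabs)
  qed (use p in auto)
  then have "(LINT x:I e0|lborel. \<bar>f e0 x\<bar> powr p) > 0"
    using ac[OF nz(1)] nz
    by (intro set_integral_pos integrands_integrable(2)[OF ac leM[OF nz(1)] M] nz)
      (auto simp: ac_pair_def)
  then show J0: "J > 0"
    unfolding J_def using Jpos S nz by (intro sum_pos2[of _ e0]) auto
  then have J'0: "J' > 0" using J M by (simp add: zero_less_mult_iff)
  have D0: "0 \<le> defect (I e) (f' e) (g' e)" if "e \<in> S" for e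
    using energy_splitting(2)[OF ac' le'] that by blast
  have D: "D \<ge> 0" unfolding D_def by (intro sum_nonneg D0)
  \<comment> \<open>For one edge the coefficient is negative, and c = 0 makes the term vanish
    instead; this is the case of the line.\<close>
  have c0: "0 \<le> (real (card S) - 2) * pot \<bar>inverse M * c\<bar>"
    using card pot_mono[of 0 "\<bar>inverse M * c\<bar>"] by auto
  have Jp: "J powr (2 / p) = M\<^sup>2 * J' powr (2 / p)"
    using M J'0 p by (simp add: J powr_mult powr_powr)
  have young: "gns_const * J' powr (2 / p) \<le> 2 * pot 1 + J'" by (rule gns_const_bound[OF J'0])
  have chain: "gns_const * J' powr (2 / p) + D + (real (card S) - 2) * pot \<bar>inverse M * c\<bar> \<le> E'"
    using young bound by linarith
  have "gns_const * J' powr (2 / p) \<le> E'" using chain D c0 by linarith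
  from mult_left_mono[OF this, of "M\<^sup>2"] show "gns_const * J powr (2 / p) \<le> E"
    by (simp add: E Jp mult_ac)
  assume "E = gns_const * J powr (2 / p)"
  then have "M\<^sup>2 * E' = M\<^sup>2 * (gns_const * J' powr (2 / p))" by (simp add: E Jp mult_ac)
  then have eq: "E' = gns_const * J' powr (2 / p)" using M by simp
  have D': "D = 0" and c': "(real (card S) - 2) * pot \<bar>inverse M * c\<bar> = 0"
    using chain D c0 unfolding eq by linarith+
  show "c = 0" if "card S > 2"
  proof (rule ccontr)
    assume "c \<noteq> 0"
    then have "pot \<bar>inverse M * c\<bar> > 0" using M by (intro pot_pos) auto
    then show False using c' that by simp
  qed
  show "(f e y)\<^sup>2 \<le> exp (2 * \<bar>y - x\<bar>) * (f e x)\<^sup>2" if "e \<in> S" "x \<in> I e" "y \<in> I e"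
  proof -
    have "defect (I e) (f' e) (g' e) = 0"
      using D' sum_nonneg_eq_0_iff[OF S, of "\<lambda>e. defect (I e) (f' e) (g' e)"] D0 that(1)
      unfolding D_def by simp
    then have "AE t in lborel. t \<in> I e \<longrightarrow> \<bar>g' e t\<bar> \<le> \<bar>f' e t\<bar>"
      using energy_splitting(3)[OF ac' le'] that(1) by blast
    from exponential_growth_bound[OF ac'[OF that(1)] this that(2,3)]
    have "(inverse M)\<^sup>2 * (f e y)\<^sup>2 \<le> (inverse M)\<^sup>2 * (exp (2 * \<bar>y - x\<bar>) * (f e x)\<^sup>2)"
      by (simp add: f'_def power_mult_distrib mult_ac)
    then show ?thesis using M by simp
  qed
qed

end

section \<open>Truncated solitons and the optimal constant on the line\<close>

lemma L2_on_cong: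
  "(\<And>x. x \<in> I \<Longrightarrow> f x = f' x) \<Longrightarrow> f \<in> L2_on I \<longleftrightarrow> f' \<in> L2_on I"
proof -
  assume eq: "\<And>x. x \<in> I \<Longrightarrow> f x = f' x"
  have "indicator I x *\<^sub>R f x = indicator I x *\<^sub>R f' x" for x
    using eq by (cases "x \<in> I") auto
  moreover have "indicator I x *\<^sub>R (f x)\<^sup>2 = indicator I x *\<^sub>R (f' x)\<^sup>2" for x
    using eq by (cases "x \<in> I") auto
  ultimately show ?thesis
    unfolding L2_on_def set_borel_measurable_def set_integrable_def by (simp only: mem_Collect_eq)
qed

lemma H1_on_weak_deriv:
  assumes "f \<in> H1_on I"
  shows "f \<in> L2_on I" "weak_deriv I f \<in> L2_on I" "has_weak_deriv I f (weak_deriv I f)"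
proof -
  have "\<exists>g. g \<in> L2_on I \<and> has_weak_deriv I f g" using assms by (auto simp: H1_on_def)
  from someI_ex[OF this] show "weak_deriv I f \<in> L2_on I" "has_weak_deriv I f (weak_deriv I f)"
    unfolding weak_deriv_def by auto
qed (use assms in \<open>simp add: H1_on_def\<close>)

lemma H1_on_ac_pair:
  assumes "f \<in> H1_on I" "open I" "is_interval I" "continuous_on I f"
  shows "ac_pair I f (weak_deriv I f)"
  using H1_on_weak_deriv[OF assms(1)] assms by (intro ac_pairI)

text \<open>\<open>weak_deriv\<close> is chosen by \<open>SOME\<close>; almost everywhere uniqueness
  lets any explicit weak derivative compute the energy.\<close>

lemma H1_energy_eq:
  assumes I: "open I" "is_interval I" and f: "continuous_on I f" "f \<in> L2_on I"
    and g: "g \<in> L2_on I" "has_weak_deriv I f g"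
  shows "f \<in> H1_on I" and "H1_energy I f = (LINT x:I|lborel. (g x)\<^sup>2 + (f x)\<^sup>2)"
proof -
  show H1: "f \<in> H1_on I" using f g by (auto simp: H1_on_def)
  let ?w = "weak_deriv I f"
  have w: "?w \<in> L2_on I" by (rule H1_on_weak_deriv[OF H1])
  have ae: "AE x in lborel. x \<in> I \<longrightarrow> ?w x = g x"
    by (rule ac_pair_unique[OF H1_on_ac_pair[OF H1 I f(1)] ac_pairI[OF I f g]])
  have m: "(\<lambda>x. indicator I x *\<^sub>R ((k x)\<^sup>2 + (f x)\<^sup>2)) \<in> borel_measurable lborel" if "k \<in> L2_on I" for k
  proof -
    note [measurable] = L2_on_measurable[OF that] L2_on_measurable[OF f(2)]
    have "indicator I x *\<^sub>R ((k x)\<^sup>2 + (f x)\<^sup>2) = (indicator I x * k x)\<^sup>2 + (indicator I x * f x)\<^sup>2" for x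
      by (cases "x \<in> I") auto
    then show ?thesis by simp
  qed
  show "H1_energy I f = (LINT x:I|lborel. (g x)\<^sup>2 + (f x)\<^sup>2)"
    unfolding H1_energy_def set_lebesgue_integral_def
  proof (rule integral_cong_AE[OF m[OF w] m[OF g(1)]])
    show "AE x in lborel. indicator I x *\<^sub>R ((?w x)\<^sup>2 + (f x)\<^sup>2) = indicator I x *\<^sub>R ((g x)\<^sup>2 + (f x)\<^sup>2)"
      using ae by eventually_elim (auto simp: indicator_def)
  qed
qed

lemma H1_zero:
  assumes I: "open I" "is_interval I" and z: "\<And>x. x \<in> I \<Longrightarrow> f x = 0"
  shows "f \<in> H1_on I" and "H1_energy I f = 0"
proof -
  have f: "f \<in> L2_on I" "(\<lambda>x. 0) \<in> L2_on I"
    using L2_on_cong[of I f "\<lambda>x. 0"] z by (auto simp: L2_on_def set_borel_measurable_def set_integrable_def)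
  have c: "continuous_on I f" using continuous_on_cong[of I I f "\<lambda>x. 0"] z by simp
  have zi: "(LINT x:I|lborel. f x * k x) = 0" for k
    using set_lebesgue_integral_cong[of I lborel "\<lambda>x. f x * k x" "\<lambda>x. 0"] z I by auto
  then have w: "has_weak_deriv I f (\<lambda>x. 0)" by (simp add: has_weak_deriv_def)
  show "f \<in> H1_on I" by (rule H1_energy_eq(1)[OF I c f w])
  show "H1_energy I f = 0"
    using H1_energy_eq(2)[OF I c f w] zi[of f] by (simp add: power2_eq_square)
qed

text \<open>Chebyshev: |f| >= e on an interval of length (N + 1) / e^2 would give f^2 an integral of
  at least N + 1. The length is independent of the position, so small values occur arbitrarily far
  out.\<close>

lemma L2_on_small_values:
  assumes f: "f \<in> L2_on I" and e: "e > 0"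
  shows "\<exists>l>0. \<forall>a. {a..a + l} \<subseteq> I \<longrightarrow> (\<exists>b\<in>{a..a + l}. \<bar>f b\<bar> < e)"
proof -
  define N where "N = (LINT x:I|lborel. (f x)\<^sup>2)"
  have N: "N \<ge> 0"
    unfolding N_def set_lebesgue_integral_def by (intro Bochner_Integration.integral_nonneg) simp
  define l where "l = (N + 1) / e\<^sup>2"
  have l: "l > 0" using N e by (simp add: l_def)
  have si: "set_integrable lborel I (\<lambda>x. (f x)\<^sup>2)" using f by (simp add: L2_on_def)
  have "\<exists>b\<in>{a..a + l}. \<bar>f b\<bar> < e" if sub: "{a..a + l} \<subseteq> I" for a
  proof (rule ccontr)
    assume "\<not> (\<exists>b\<in>{a..a + l}. \<bar>f b\<bar> < e)"
    then have ge: "e\<^sup>2 \<le> (f b)\<^sup>2" if "b \<in> {a..a + l}" for b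
      using that e power_mono[of e "\<bar>f b\<bar>" 2] by force
    have "N + 1 = (LINT x:{a..a + l}|lborel. e\<^sup>2)"
      using l e by (simp add: set_lebesgue_integral_def l_def)
    also have "\<dots> \<le> N"
      unfolding N_def set_lebesgue_integral_def
    proof (rule integral_mono)
      show "integrable lborel (\<lambda>x. indicator {a..a + l} x *\<^sub>R e\<^sup>2)"
        using borel_integrable_atLeastAtMost'[of a "a + l" "\<lambda>x. e\<^sup>2"] by (simp add: set_integrable_def)
      show "integrable lborel (\<lambda>x. indicator I x *\<^sub>R (f x)\<^sup>2)" using si by (simp add: set_integrable_def)
      fix x
      show "indicator {a..a + l} x *\<^sub>R e\<^sup>2 \<le> indicator I x *\<^sub>R (f x)\<^sup>2"
      proof (cases "x \<in> {a..a + l}")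
        case True
        then have "x \<in> I" using sub by blast
        then show ?thesis using ge[OF True] True by simp
      qed simp
    qed
    finally show False by simp
  qed
  then show ?thesis using l by blast
qed

lemma set_integral_shift:
  fixes h :: "real \<Rightarrow> real"
  shows "(LINT t:{c - L..c + L}|lborel. h (t - c)) = (LINT x:{- L..L}|lborel. h x)"
proof -
  have "(LINT t:{c - L..c + L}|lborel. h (t - c)) =
      (\<integral>x. indicator {c - L..c + L} (c + x) *\<^sub>R h x \<partial>lborel)"
    unfolding set_lebesgue_integral_def
    by (subst lborel_integral_real_affine[of 1 _ c]) auto
  also have "\<dots> = (LINT x:{- L..L}|lborel. h x)"
    unfolding set_lebesgue_integral_def
    by (intro Bochner_Integration.integral_cong) (auto simp: indicator_def)
  finally show ?thesis .
qed

lemma set_integral_restrict: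
  fixes f :: "real \<Rightarrow> real"
  assumes "A \<subseteq> I" "\<And>x. x \<in> A \<Longrightarrow> f x = h x" "\<And>x. x \<in> I - A \<Longrightarrow> f x = 0"
  shows "(LINT x:I|lborel. f x) = (LINT x:A|lborel. h x)"
  unfolding set_lebesgue_integral_def
proof (rule Bochner_Integration.integral_cong[OF refl])
  fix x
  show "indicator I x *\<^sub>R f x = indicator A x *\<^sub>R h x"
    using assms(2,3)[of x] subsetD[OF assms(1), of x] by (cases "x \<in> A"; cases "x \<in> I") auto
qed

lemma L2_on_truncation:
  assumes I: "open I" and sub: "{a..b} \<subseteq> I" and h: "continuous_on UNIV h"
    and eq: "\<And>x. x \<in> {a..b} \<Longrightarrow> f x = h x" "\<And>x. x \<in> I - {a..b} \<Longrightarrow> f x = 0"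
  shows "f \<in> L2_on I"
proof -
  have eq': "indicator I x *\<^sub>R f x = indicator {a..b} x * h x" for x
    using eq[of x] subsetD[OF sub, of x] by (cases "x \<in> {a..b}"; cases "x \<in> I") auto
  have sq: "indicator I x *\<^sub>R (f x)\<^sup>2 = indicator {a..b} x *\<^sub>R (h x)\<^sup>2" for x
    using eq[of x] subsetD[OF sub, of x] by (cases "x \<in> {a..b}"; cases "x \<in> I") auto
  note [measurable] = borel_measurable_continuous_onI[OF h]
  have "set_integrable lborel {a..b} (\<lambda>x. (h x)\<^sup>2)"
    by (intro borel_integrable_atLeastAtMost' continuous_intros continuous_on_subset[OF h]) auto
  then show ?thesis
    unfolding L2_on_def set_borel_measurable_def set_integrable_def mem_Collect_eq eq' sq by auto
qed

lemma test_function_DERIV: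
  assumes "\<phi> \<in> test_functions I"
  shows "(\<phi> has_real_derivative deriv \<phi> x) (at x)" "isCont (deriv \<phi>) x"
proof -
  obtain D where D: "\<And>x. (\<phi> has_real_derivative D x) (at x)" "continuous_on UNIV D"
    using assms by (auto simp: test_functions_def C1_differentiable_on_def has_real_derivative_iff_has_vector_derivative)
  then have "deriv \<phi> = D" by (auto simp: fun_eq_iff intro: DERIV_imp_deriv)
  then show "(\<phi> has_real_derivative deriv \<phi> x) (at x)" "isCont (deriv \<phi>) x"
    using D by (auto simp: continuous_on_eq_continuous_at)
qed

section \<open>Translated truncated solitons and the constant on the line\<close>

context gns_exponent
begin

text \<open>Clamping the argument to [-L, L] presents the truncated, lowered and translated soliton
  as a composition of continuous functions.\<close>

definition bump :: "real \<Rightarrow> real \<Rightarrow> real \<Rightarrow> real" where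
  "bump c L t = soliton (max (- L) (min L (t - c))) - soliton L"

lemma continuous_bump: "continuous_on A (bump c L)"
  unfolding bump_def[abs_def]
  by (intro continuous_intros continuous_on_compose2[OF continuous_on_soliton[of UNIV]]) auto

lemma bump_inside: "t \<in> {c - L..c + L} \<Longrightarrow> bump c L t = soliton (t - c) - soliton L"
  by (simp add: bump_def)

lemma bump_outside: "L > 0 \<Longrightarrow> t \<notin> {c - L..c + L} \<Longrightarrow> bump c L t = 0"
  by (auto simp: bump_def min_def max_def)

text \<open>Agreement with \<open>bump\<close> is required on \<open>I\<close> only, because a graph
  function is seen through the parametrization of an edge.\<close>

lemma bump_H1:
  assumes I: "open I" "is_interval I" and L: "L > 0" and sub: "{c - L..c + L} \<subseteq> I"
    and f: "\<And>t. t \<in> I \<Longrightarrow> f t = bump c L t"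
  shows "f \<in> H1_on I"
    and "H1_energy I f =
      (LINT x:{- L..L}|lborel. (tanh (rate * x) * soliton x)\<^sup>2 + (soliton x - soliton L)\<^sup>2)"
    and "(LINT t:I|lborel. \<bar>f t\<bar> powr p) = (LINT x:{- L..L}|lborel. \<bar>soliton x - soliton L\<bar> powr p)"
proof -
  define K where "K = {c - L..c + L}"
  define h where "h t = soliton (t - c) - soliton L" for t
  define h' where "h' t = - (tanh (rate * (t - c)) * soliton (t - c))" for t
  define g where "g t = (if t \<in> K then h' t else 0)" for t
  have subK: "K \<subseteq> I" using sub by (simp add: K_def)
  have fK: "f t = h t" if "t \<in> K" for t
    using that f[of t] subK bump_inside by (auto simp: K_def h_def)
  have f0: "f t = 0" if "t \<in> I - K" for t
    using that f[of t] bump_outside[OF L] by (auto simp: K_def)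
  have ch: "continuous_on UNIV h"
    unfolding h_def by (intro continuous_intros continuous_on_compose2[OF continuous_on_soliton[of UNIV]]) auto
  have ch': "continuous_on UNIV h'"
    unfolding h'_def
    by (intro continuous_intros continuous_on_compose2[OF continuous_on_soliton[of UNIV]]
        continuous_on_compose2[OF continuous_on_tanh_rate[of UNIV], of _ "\<lambda>t. t - c"]) auto
  have Dh: "(h has_real_derivative h' t) (at t)" for t
  proof -
    have "((\<lambda>t. soliton (t - c)) has_real_derivative h' t * 1) (at t)"
      unfolding h'_def by (rule DERIV_chain2[OF DERIV_soliton]) (auto intro!: derivative_eq_intros)
    from DERIV_diff[OF this DERIV_const] show ?thesis unfolding h_def[abs_def] by simp
  qed
  have cf: "continuous_on I f"
    using continuous_bump[of I c L] f by (simp cong: continuous_on_cong)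
  have Lf: "f \<in> L2_on I"
    by (rule L2_on_truncation[OF I(1) sub ch]) (use fK f0 in \<open>auto simp: K_def\<close>)
  have Lg: "g \<in> L2_on I"
    by (rule L2_on_truncation[OF I(1) sub ch']) (auto simp: K_def g_def)
  have w: "has_weak_deriv I f g"
    unfolding has_weak_deriv_def
  proof
    fix \<phi> assume \<phi>: "\<phi> \<in> test_functions I"
    \<comment> \<open>Integration by parts on the support; the boundary terms vanish because the
      soliton was lowered by its end value. The jumps of the derivative at the two ends are
      therefore harmless.\<close>
    have "(\<integral>x. indicator K x *\<^sub>R (h x * deriv \<phi> x) \<partial>lborel) =
        h (c + L) * \<phi> (c + L) - h (c - L) * \<phi> (c - L) - (\<integral>x. indicator K x *\<^sub>R (h' x * \<phi> x) \<partial>lborel)"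
      unfolding K_def
      by (rule integral_by_parts')
        (use L ch' test_function_DERIV[OF \<phi>] Dh in \<open>auto simp: continuous_on_eq_continuous_at\<close>)
    moreover have "h (c + L) = 0" "h (c - L) = 0" by (simp_all add: h_def)
    moreover have "(LINT x:I|lborel. f x * deriv \<phi> x) = (LINT x:K|lborel. h x * deriv \<phi> x)"
      by (rule set_integral_restrict[OF subK]) (simp_all add: fK f0)
    moreover have "(LINT x:I|lborel. g x * \<phi> x) = (LINT x:K|lborel. h' x * \<phi> x)"
      by (rule set_integral_restrict[OF subK]) (simp_all add: g_def)
    ultimately show "(LINT x:I|lborel. f x * deriv \<phi> x) = - (LINT x:I|lborel. g x * \<phi> x)"
      by (simp add: set_lebesgue_integral_def)
  qed
  show "f \<in> H1_on I" by (rule H1_energy_eq(1)[OF I cf Lf Lg w])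
  have "H1_energy I f = (LINT x:K|lborel. (h' x)\<^sup>2 + (h x)\<^sup>2)"
    unfolding H1_energy_eq(2)[OF I cf Lf Lg w]
    by (rule set_integral_restrict[OF subK]) (simp_all add: fK f0 g_def)
  also have "\<dots> = (LINT x:{- L..L}|lborel. (tanh (rate * x) * soliton x)\<^sup>2 + (soliton x - soliton L)\<^sup>2)"
    unfolding K_def h_def h'_def power2_minus
    by (rule set_integral_shift[of c L "\<lambda>x. (tanh (rate * x) * soliton x)\<^sup>2 + (soliton x - soliton L)\<^sup>2"])
  finally show "H1_energy I f =
      (LINT x:{- L..L}|lborel. (tanh (rate * x) * soliton x)\<^sup>2 + (soliton x - soliton L)\<^sup>2)" .
  have "(LINT t:I|lborel. \<bar>f t\<bar> powr p) = (LINT t:K|lborel. \<bar>h t\<bar> powr p)"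
    by (rule set_integral_restrict[OF subK]) (use p in \<open>simp_all add: fK f0\<close>)
  also have "\<dots> = (LINT x:{- L..L}|lborel. \<bar>soliton x - soliton L\<bar> powr p)"
    unfolding K_def h_def
    by (rule set_integral_shift[of c L "\<lambda>x. \<bar>soliton x - soliton L\<bar> powr p"])
  finally show "(LINT t:I|lborel. \<bar>f t\<bar> powr p) = (LINT x:{- L..L}|lborel. \<bar>soliton x - soliton L\<bar> powr p)" .
qed

text \<open>A sharp inequality together with near optimal functions determines the admissible
  constants as the half-line from 1 / gns_const on. The functionals are abstract so that line and
  graph share the argument.\<close>

lemma optimal_constants:
  fixes E J :: "'v \<Rightarrow> real"
  assumes bound: "\<And>v. v \<in> X \<Longrightarrow> gns_const * J v powr (2 / p) \<le> E v"
    and near: "\<And>K. K > gns_const \<Longrightarrow> \<exists>v\<in>X. J v > 0 \<and> E v < K * J v powr (2 / p)"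
  shows "Inf {C. \<forall>v\<in>X. J v powr (2 / p) \<le> C * E v} = 1 / gns_const"
proof -
  have "{C. \<forall>v\<in>X. J v powr (2 / p) \<le> C * E v} = {1 / gns_const..}"
  proof (intro set_eqI iffI)
    fix C assume "C \<in> {C. \<forall>v\<in>X. J v powr (2 / p) \<le> C * E v}"
    then have C: "\<And>v. v \<in> X \<Longrightarrow> J v powr (2 / p) \<le> C * E v" by blast
    \<comment> \<open>Positivity comes first because 1 / C serves as the value \<open>K\<close> in
      the contradiction.\<close>
    have C0: "C > 0"
    proof (rule ccontr)
      assume "\<not> C > 0"
      obtain v where v: "v \<in> X" "J v > 0" using near[of "gns_const + 1"] by auto
      then have "J v powr (2 / p) > 0" by simp
      moreover have "E v \<ge> 0" using bound[OF v(1)] gns_const_pos by (meson order_trans mult_nonneg_nonneg powr_ge_zero less_imp_le)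
      moreover have "C * E v \<le> 0" using \<open>\<not> C > 0\<close> \<open>E v \<ge> 0\<close> by (simp add: mult_nonpos_nonneg)
      ultimately show False using C[OF v(1)] by linarith
    qed
    show "C \<in> {1 / gns_const..}"
    proof (rule ccontr)
      assume "C \<notin> {1 / gns_const..}"
      then have "1 / C > gns_const" using C0 gns_const_pos by (simp add: field_simps)
      then obtain v where v: "v \<in> X" "E v < 1 / C * J v powr (2 / p)" using near by blast
      then show False using C[OF v(1)] C0 by (simp add: field_simps)
    qed
  next
    fix C assume C: "C \<in> {1 / gns_const..}"
    have "J v powr (2 / p) \<le> C * E v" if "v \<in> X" for v
    proof -
      have E0: "E v \<ge> 0" using bound[OF that] gns_const_pos by (meson order_trans mult_nonneg_nonneg powr_ge_zero less_imp_le)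
      have "J v powr (2 / p) \<le> 1 / gns_const * E v" using bound[OF that] gns_const_pos by (simp add: field_simps)
      also have "\<dots> \<le> C * E v" using C E0 by (intro mult_right_mono) auto
      finally show ?thesis .
    qed
    then show "C \<in> {C. \<forall>v\<in>X. J v powr (2 / p) \<le> C * E v}" by blast
  qed
  then show ?thesis by simp
qed

text \<open>The line is a network with the single edge \<open>UNIV\<close>; both of its ends lie at
  infinity, where c = 0.\<close>

lemma best_const_line_eq: "best_const_line p = 1 / gns_const"
proof -
  let ?X = "{f \<in> H1_on UNIV. continuous_on UNIV f}"
  have "best_const_line p =
      Inf {C. \<forall>f\<in>?X. (LINT x:UNIV|lborel. \<bar>f x\<bar> powr p) powr (2 / p) \<le> C * H1_energy UNIV f}"
    unfolding best_const_line_def by (rule arg_cong[of _ _ Inf]) (auto simp: set_lebesgue_integral_def)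
  also have "\<dots> = 1 / gns_const"
  proof (rule optimal_constants)
    fix f assume "f \<in> ?X"
    then have f: "f \<in> H1_on UNIV" "continuous_on UNIV f" by auto
    show "gns_const * (LINT x:UNIV|lborel. \<bar>f x\<bar> powr p) powr (2 / p) \<le> H1_energy UNIV f"
    proof (cases "\<exists>x. f x \<noteq> 0")
      case True
      then obtain x0 where x0: "f x0 \<noteq> 0" by blast
      have L: "f \<in> L2_on UNIV" by (rule H1_on_weak_deriv[OF f(1)])
      have ends: "ends UNIV f 0 0"
        unfolding ends_def
      proof (intro ballI allI impI)
        fix x e :: real assume e: "e > 0"
        obtain l where l: "l > 0" "\<And>a. \<exists>b\<in>{a..a + l}. \<bar>f b\<bar> < e"
          using L2_on_small_values[OF L e] by auto
        obtain a where "a \<in> {x - l - 1..x - l - 1 + l}" "\<bar>f a\<bar> < e" using l(2) by blast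
        moreover obtain b where "b \<in> {x + 1..x + 1 + l}" "\<bar>f b\<bar> < e" using l(2) by blast
        ultimately show "\<exists>a\<in>UNIV. \<exists>b\<in>UNIV. a < x \<and> x < b \<and> \<bar>f a - 0\<bar> < e \<and> \<bar>f b - 0\<bar> < e"
          by (intro bexI[of _ a] bexI[of _ b]) auto
      qed
      have ac: "ac_pair UNIV f (weak_deriv UNIV f)"
        by (rule H1_on_ac_pair[OF f(1) _ _ f(2)]) auto
      show ?thesis
        using network_bound(2)[of "{()}" "\<lambda>_. UNIV" "\<lambda>_. f" "\<lambda>_. weak_deriv UNIV f" 0 "()" x0] ac ends x0
        by (simp add: H1_energy_def)
    next
      case False
      then show ?thesis using H1_zero(2)[of UNIV f] p by simp
    qed
  next
    fix K assume "K > gns_const"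
    then obtain L where L: "L > 0"
      "(LINT x:{- L..L}|lborel. \<bar>soliton x - soliton L\<bar> powr p) > 0"
      "(LINT x:{- L..L}|lborel. (tanh (rate * x) * soliton x)\<^sup>2 + (soliton x - soliton L)\<^sup>2)
         < K * (LINT x:{- L..L}|lborel. \<bar>soliton x - soliton L\<bar> powr p) powr (2 / p)"
      by (rule near_extremal)
    have U: "open (UNIV :: real set)" "is_interval (UNIV :: real set)" by auto
    note b = bump_H1[OF U L(1) subset_UNIV[of "{0 - L..0 + L}"] refl]
    show "\<exists>f\<in>?X. (LINT x:UNIV|lborel. \<bar>f x\<bar> powr p) > 0 \<and>
        H1_energy UNIV f < K * (LINT x:UNIV|lborel. \<bar>f x\<bar> powr p) powr (2 / p)"
      by (rule bexI[of _ "bump 0 L"]) (use b L continuous_bump in auto)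
  qed
  finally show ?thesis .
qed

end

section \<open>Star graphs\<close>

text \<open>Integrals live on the open interval \<open>edge_dom\<close>, but the values at the
  vertices belong to the end points of its closure.\<close>

fun edge_closed_dom :: "edge \<Rightarrow> real set" where
  "edge_closed_dom (Bounded a b) = {0..dist a b}"
| "edge_closed_dom (Unbounded a u) = {0..}"

lemma edge_dom_open_interval [simp]: "open (edge_dom e)" "is_interval (edge_dom e)"
  by (cases e; simp)+

lemma edge_dom_ne: "edge_ok e \<Longrightarrow> edge_dom e \<noteq> {}"
  by (cases e) (auto simp: greaterThanLessThan_empty_iff)

lemma edge_dom_subset: "edge_dom e \<subseteq> edge_closed_dom e"
  by (cases e) auto

lemma closure_edge_dom: "edge_ok e \<Longrightarrow> closure (edge_dom e) = edge_closed_dom e"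
  by (cases e) (auto simp: closure_greaterThanLessThan)

lemma edge_param_continuous: "continuous_on A (edge_param e)"
  by (cases e) (auto intro!: continuous_intros)

lemma edge_param_end:
  "a \<noteq> b \<Longrightarrow> edge_param (Bounded a b) (dist a b) = b"
  by (simp add: sgn_div_norm dist_norm norm_minus_commute)

lemma edge_set_eq_param:
  assumes "edge_ok e" shows "edge_set e = edge_param e ` edge_closed_dom e"
proof (cases e)
  case (Bounded a b)
  then have d: "dist a b > 0" using assms by simp
  have eq: "a + (s * dist a b) *\<^sub>R sgn (b - a) = (1 - s) *\<^sub>R a + s *\<^sub>R b" for s
    using d by (simp add: sgn_div_norm dist_norm norm_minus_commute algebra_simps)
  show ?thesis
    unfolding Bounded edge_set.simps edge_closed_dom.simps
  proof (intro equalityI subsetI)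
    fix x assume "x \<in> closed_segment a b"
    then obtain s where s: "0 \<le> s" "s \<le> 1" "x = (1 - s) *\<^sub>R a + s *\<^sub>R b" by (auto simp: closed_segment_def)
    then have "x = edge_param (Bounded a b) (s * dist a b)" using eq by simp
    moreover have "s * dist a b \<in> {0..dist a b}" using s d by (auto simp: mult_left_le_one_le)
    ultimately show "x \<in> edge_param (Bounded a b) ` {0..dist a b}" by blast
  next
    fix x assume "x \<in> edge_param (Bounded a b) ` {0..dist a b}"
    then obtain t where t: "0 \<le> t" "t \<le> dist a b" "x = a + t *\<^sub>R sgn (b - a)" by auto
    then have "x = (1 - t / dist a b) *\<^sub>R a + (t / dist a b) *\<^sub>R b" using eq[of "t / dist a b"] d by simp
    then show "x \<in> closed_segment a b"
      using t d unfolding closed_segment_def by (auto intro!: exI[of _ "t / dist a b"])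
  qed
next
  case (Unbounded a u)
  then show ?thesis by auto
qed

text \<open>A half-line consists of the points that equal their projection onto its direction and
  have a nonnegative coordinate. Closedness is used to glue continuous functions.\<close>

lemma closed_edge_set: "edge_ok e \<Longrightarrow> closed (edge_set e)"
proof (cases e)
  case (Unbounded a u)
  assume "edge_ok e"
  then have u: "norm u = 1" using Unbounded by simp
  then have uu: "u \<bullet> u = 1" by (simp add: dot_square_norm)
  have "edge_set e = {x. x = a + ((x - a) \<bullet> u) *\<^sub>R u} \<inter> {x. 0 \<le> (x - a) \<bullet> u}"
  proof (intro equalityI subsetI)
    fix x assume "x \<in> edge_set e"
    then obtain t where "0 \<le> t" "x = a + t *\<^sub>R u" using Unbounded by auto
    then show "x \<in> {x. x = a + ((x - a) \<bullet> u) *\<^sub>R u} \<inter> {x. 0 \<le> (x - a) \<bullet> u}" using uu by simp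
  qed (use Unbounded in auto)
  then show ?thesis
    by (simp only:) (intro closed_Int closed_Collect_eq closed_Collect_le continuous_intros)
qed simp

lemma edge_ends_subset_edge_set: "edge_ends e \<subseteq> edge_set e"
  by (cases e) (auto intro!: exI[of _ 0])

text \<open>\<open>P\<close> may be either end point of a bounded edge; \<open>z\<close> is its
  parameter and \<open>z'\<close> that of the opposite end, which hides the orientation from later
  arguments.\<close>

lemma edge_at_vertex:
  assumes "edge_ok e" "P \<in> edge_ends e"
  obtains z where "z \<in> edge_closed_dom e" "edge_param e z = P"
    "(\<exists>w. e = Unbounded P w \<and> z = 0) \<or>
     (\<exists>z'\<in>edge_closed_dom e. edge_param e z' \<noteq> P \<and> edge_param e z' \<in> edge_ends e \<and>
       {z, z'} = {0, Sup (edge_dom e)} \<and> edge_dom e = {0<..<Sup (edge_dom e)} \<and> z \<noteq> z')"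
proof (cases e)
  case (Bounded a b)
  then have d: "dist a b > 0" "a \<noteq> b" using assms by auto
  then have S: "Sup (edge_dom e) = dist a b" using Bounded by simp
  have ab: "edge_param e 0 = a" "edge_param e (dist a b) = b"
    using Bounded edge_param_end[OF d(2)] by auto
  show ?thesis
  proof (cases "P = a")
    case True
    then show ?thesis using Bounded d S ab
      by (intro that[of 0]) (auto intro!: disjI2 bexI[of _ "dist a b"])
  next
    case False
    then have "P = b" using assms Bounded by auto
    show ?thesis
    proof (rule that[of "dist a b"], goal_cases)
      case 3
      have "edge_param e 0 \<noteq> P \<and> edge_param e 0 \<in> edge_ends e \<and> {dist a b, 0} = {0, Sup (edge_dom e)} \<and>
          edge_dom e = {0<..<Sup (edge_dom e)} \<and> dist a b \<noteq> 0"
        using \<open>P = b\<close> Bounded d S by auto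
      moreover have "0 \<in> edge_closed_dom e" using Bounded by simp
      ultimately show ?case by blast
    qed (use \<open>P = b\<close> Bounded ab in auto)
  qed
next
  case (Unbounded a u)
  then show ?thesis using assms by (intro that[of 0]) auto
qed

section \<open>Behaviour at the ends of an edge\<close>

lemma ends_Ioo:
  assumes "continuous_on {0..d} F" shows "ends {0<..<d} F (F 0) (F d)"
  unfolding ends_def
proof (intro ballI allI impI)
  fix x e :: real assume x: "x \<in> {0<..<d}" and e: "e > 0"
  obtain r where r: "r > 0" "\<And>t. t \<in> {0..d} \<Longrightarrow> dist t 0 < r \<Longrightarrow> dist (F t) (F 0) < e"
    using assms x e unfolding continuous_on_iff by fastforce
  obtain s where s: "s > 0" "\<And>t. t \<in> {0..d} \<Longrightarrow> dist t d < s \<Longrightarrow> dist (F t) (F d) < e"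
    using assms x e unfolding continuous_on_iff by fastforce
  \<comment> \<open>Half the minimum is both within the continuity radius of the end and on the
    correct side of \<open>x\<close>.\<close>
  have "min r x / 2 \<in> {0<..<d}" "min r x / 2 < x" "\<bar>F (min r x / 2) - F 0\<bar> < e"
    using x r(1) r(2)[of "min r x / 2"] by (auto simp: dist_real_def min_def)
  moreover have "d - min s (d - x) / 2 \<in> {0<..<d}" "x < d - min s (d - x) / 2" "\<bar>F (d - min s (d - x) / 2) - F d\<bar> < e"
    using x s(1) s(2)[of "d - min s (d - x) / 2"] by (auto simp: dist_real_def min_def field_simps)
  ultimately show "\<exists>a\<in>{0<..<d}. \<exists>b\<in>{0<..<d}. a < x \<and> x < b \<and> \<bar>F a - F 0\<bar> < e \<and> \<bar>F b - F d\<bar> < e"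
    by blast
qed

lemma ends_half_line:
  assumes "continuous_on {0..} F" and L: "F \<in> L2_on {0<..}" shows "ends {0<..} F (F 0) 0"
  unfolding ends_def
proof (intro ballI allI impI)
  fix x e :: real assume x: "x \<in> {0<..}" and e: "e > 0"
  obtain r where r: "r > 0" "\<And>t. t \<in> {0..} \<Longrightarrow> dist t 0 < r \<Longrightarrow> dist (F t) (F 0) < e"
    using assms(1) x e unfolding continuous_on_iff by fastforce
  have 1: "min r x / 2 \<in> {0<..}" "min r x / 2 < x" "\<bar>F (min r x / 2) - F 0\<bar> < e"
    using x r(1) r(2)[of "min r x / 2"] by (auto simp: dist_real_def min_def)
  obtain l where l: "l > 0" "\<And>a. {a..a + l} \<subseteq> {0<..} \<Longrightarrow> \<exists>b\<in>{a..a + l}. \<bar>F b\<bar> < e"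
    using L2_on_small_values[OF L e] by auto
  have "{x + 1..x + 1 + l} \<subseteq> {0<..}" using x by auto
  from l(2)[OF this] obtain b where "b \<in> {x + 1..x + 1 + l}" "\<bar>F b\<bar> < e" by blast
  then have "b \<in> {0<..}" "x < b" "\<bar>F b - 0\<bar> < e" using x by auto
  with 1 show "\<exists>a\<in>{0<..}. \<exists>b\<in>{0<..}. a < x \<and> x < b \<and> \<bar>F a - F 0\<bar> < e \<and> \<bar>F b - 0\<bar> < e"
    by blast
qed

text \<open>Let x tend to the end point in the growth bound: its right-hand side tends to 0 while
  the left-hand side stays fixed.\<close>

lemma zero_from_endpoint:
  fixes F :: "real \<Rightarrow> real"
  assumes F: "continuous_on (closure I) F" and z: "z \<in> closure I" "F z = 0"
    and growth: "\<And>x y. x \<in> I \<Longrightarrow> y \<in> I \<Longrightarrow> (F y)\<^sup>2 \<le> exp (2 * \<bar>y - x\<bar>) * (F x)\<^sup>2"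
    and y: "y \<in> I"
  shows "F y = 0"
proof -
  obtain x where x: "\<And>n. x n \<in> I" "x \<longlonglongrightarrow> z" using z(1) closure_sequential[of z I] by blast
  have "(\<lambda>n. F (x n)) \<longlonglongrightarrow> F z"
    using F z(1) x closure_subset unfolding continuous_on_sequentially comp_def by blast
  then have "(\<lambda>n. exp (2 * \<bar>y - x n\<bar>) * (F (x n))\<^sup>2) \<longlonglongrightarrow> exp (2 * \<bar>y - z\<bar>) * (F z)\<^sup>2"
    by (intro tendsto_intros x)
  then have "(F y)\<^sup>2 \<le> exp (2 * \<bar>y - z\<bar>) * (F z)\<^sup>2"
    by (rule LIMSEQ_le_const) (use growth x(1) y in blast)
  then show ?thesis using z(2) by simp
qed

lemma zero_on_closure:
  fixes F :: "real \<Rightarrow> real"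
  assumes F: "continuous_on (closure I) F" and 0: "\<And>x. x \<in> I \<Longrightarrow> F x = 0" and z: "z \<in> closure I"
  shows "F z = 0"
  using continuous_constant_on_closure[OF F 0 z] .

section \<open>The star graph\<close>

locale star_graph = gns_exponent p for p :: real +
  fixes G :: graph and P u :: plane
  assumes metric: "metric_graph G"
    and finite_edges: "finite (edges G)"
    and half_line: "Unbounded P u \<in> edges G"
    and at_P: "\<And>e. e \<in> edges G \<Longrightarrow> P \<in> edge_ends e"
    and inner: "inner_verts G = {P}"
    and not_line: "\<not> (\<exists>w. edges G = {Unbounded P u, Unbounded P w})"
begin

lemma edge_ok: "e \<in> edges G \<Longrightarrow> edge_ok e"
  using metric by (auto simp: metric_graph_def)

lemma outer_vertex: "w \<in> verts G \<Longrightarrow> w \<noteq> P \<Longrightarrow> w \<in> outer_verts G"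
  using inner by (auto simp: inner_verts_def)

lemma P_not_outer: "P \<notin> outer_verts G"
  using inner by (auto simp: inner_verts_def)

lemma P_vert: "P \<in> verts G"
  using inner by (auto simp: inner_verts_def)

text \<open>A single edge would make \<open>P\<close> an outer vertex.\<close>

lemma card_edges: "card (edges G) \<ge> 2"
proof (rule ccontr)
  assume "\<not> card (edges G) \<ge> 2"
  then have "card (edges G) \<le> Suc 0" by simp
  then have single: "e = Unbounded P u" if "e \<in> edges G" for e
    using card_le_Suc0_iff_eq[OF finite_edges] that half_line by blast
  have "\<exists>!e. e \<in> edges G \<and> P \<in> edge_ends e"
  proof (rule ex1I[of _ "Unbounded P u"])
    show "e = Unbounded P u" if "e \<in> edges G \<and> P \<in> edge_ends e" for e
      by (rule single) (use that in blast)
  qed (use half_line at_P in blast)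
  then have "P \<in> outer_verts G"
    using P_vert by (simp add: outer_verts_def)
  then show False using P_not_outer by simp
qed

lemma graph_points_eq: "graph_points G = (\<Union>e\<in>edges G. edge_set e)"
proof -
  have "w \<in> (\<Union>e\<in>edges G. edge_set e)" if "w \<in> verts G" for w
  proof (cases "w = P")
    case True
    then show ?thesis using half_line edge_ends_subset_edge_set at_P by blast
  next
    case False
    then have "w \<in> outer_verts G" using outer_vertex that by blast
    then obtain e where "e \<in> edges G" "w \<in> edge_ends e" by (auto simp: outer_verts_def)
    then show ?thesis using edge_ends_subset_edge_set by blast
  qed
  then show ?thesis by (auto simp: graph_points_def)
qed

lemma edge_continuous:
  assumes "continuous_on (graph_points G) v" "e \<in> edges G"
  shows "continuous_on (closure (edge_dom e)) (v \<circ> edge_param e)"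
proof -
  have "edge_param e ` closure (edge_dom e) \<subseteq> graph_points G"
    using assms(2) edge_ok[OF assms(2)] by (auto simp: graph_points_eq closure_edge_dom edge_set_eq_param)
  then show ?thesis
    by (intro continuous_on_compose edge_param_continuous continuous_on_subset[OF assms(1)])
qed

text \<open>The far end of an edge is infinity or a vertex other than \<open>P\<close>. Such a
  vertex is outer, so the Dirichlet condition applies there, and in both cases the limit is
  0.\<close>

lemma H10_edge:
  assumes v: "v \<in> H10_graph G" and e: "e \<in> edges G"
  shows "ac_pair (edge_dom e) (v \<circ> edge_param e) (weak_deriv (edge_dom e) (v \<circ> edge_param e))"
    and "ends (edge_dom e) (v \<circ> edge_param e) (v P) 0 \<or> ends (edge_dom e) (v \<circ> edge_param e) 0 (v P)"
    and "\<exists>z\<in>closure (edge_dom e). edge_param e z = P"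
    and "(\<forall>w. e \<noteq> Unbounded P w) \<Longrightarrow> \<exists>z\<in>closure (edge_dom e). v (edge_param e z) = 0"
proof -
  define F where "F = v \<circ> edge_param e"
  have cv: "continuous_on (graph_points G) v" and H1: "F \<in> H1_on (edge_dom e)"
    and outer: "\<And>w. w \<in> outer_verts G \<Longrightarrow> v w = 0"
    using v e by (auto simp: H10_graph_def H1_graph_def F_def)
  have c: "continuous_on (closure (edge_dom e)) F"
    unfolding F_def by (rule edge_continuous[OF cv e])
  have ok: "edge_ok e" and cl: "closure (edge_dom e) = edge_closed_dom e"
    using edge_ok[OF e] closure_edge_dom by auto
  have verts: "edge_ends e \<subseteq> verts G" using metric e by (auto simp: metric_graph_def)
  show "ac_pair (edge_dom e) (v \<circ> edge_param e) (weak_deriv (edge_dom e) (v \<circ> edge_param e))"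
    unfolding F_def[symmetric]
    by (rule H1_on_ac_pair[OF H1]) (auto intro: continuous_on_subset[OF c closure_subset])
  obtain z where z: "z \<in> edge_closed_dom e" "edge_param e z = P"
    and alt: "(\<exists>w. e = Unbounded P w \<and> z = 0) \<or>
     (\<exists>z'\<in>edge_closed_dom e. edge_param e z' \<noteq> P \<and> edge_param e z' \<in> edge_ends e \<and>
       {z, z'} = {0, Sup (edge_dom e)} \<and> edge_dom e = {0<..<Sup (edge_dom e)} \<and> z \<noteq> z')"
    by (rule edge_at_vertex[OF ok at_P[OF e]])
  show "\<exists>z\<in>closure (edge_dom e). edge_param e z = P" using z cl by auto
  have Fz: "F z = v P" using z by (simp add: F_def)
  from alt have "(ends (edge_dom e) F (v P) 0 \<or> ends (edge_dom e) F 0 (v P)) \<and>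
      ((\<forall>w. e \<noteq> Unbounded P w) \<longrightarrow> (\<exists>z\<in>closure (edge_dom e). v (edge_param e z) = 0))"
  proof
    assume "\<exists>w. e = Unbounded P w \<and> z = 0"
    then obtain w where w: "e = Unbounded P w" "z = 0" by blast
    have "ends {0<..} F (F 0) 0"
      by (rule ends_half_line) (use c cl w H1_on_weak_deriv(1)[OF H1] in auto)
    then show ?thesis using w Fz by simp
  next
    assume "\<exists>z'\<in>edge_closed_dom e. edge_param e z' \<noteq> P \<and> edge_param e z' \<in> edge_ends e \<and>
       {z, z'} = {0, Sup (edge_dom e)} \<and> edge_dom e = {0<..<Sup (edge_dom e)} \<and> z \<noteq> z'"
    then obtain z' d where z': "z' \<in> edge_closed_dom e" "edge_param e z' \<noteq> P" "edge_param e z' \<in> edge_ends e"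
      and d: "{z, z'} = {0, d}" "edge_dom e = {0<..<d}" by blast
    have Fz': "F z' = 0" using outer[OF outer_vertex] verts z' by (auto simp: F_def)
    have "d > 0" using edge_dom_ne[OF ok] d(2) by auto
    then have "ends {0<..<d} F (F 0) (F d)"
      by (intro ends_Ioo) (use c d(2) closure_greaterThanLessThan in auto)
    moreover have "(z = 0 \<and> z' = d) \<or> (z = d \<and> z' = 0)" using d(1) by (auto simp: doubleton_eq_iff)
    ultimately show ?thesis using Fz Fz' d(2) z'(1) cl by (auto simp: F_def)
  qed
  then show "ends (edge_dom e) (v \<circ> edge_param e) (v P) 0 \<or> ends (edge_dom e) (v \<circ> edge_param e) 0 (v P)"
    and "(\<forall>w. e \<noteq> Unbounded P w) \<Longrightarrow> \<exists>z\<in>closure (edge_dom e). v (edge_param e z) = 0"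
    by (auto simp: F_def)
qed

lemma graph_energy_eq:
  "graph_energy G v = (\<Sum>e\<in>edges G. LINT x:edge_dom e|lborel.
     (weak_deriv (edge_dom e) (v \<circ> edge_param e) x)\<^sup>2 + ((v \<circ> edge_param e) x)\<^sup>2)"
  using finite_edges by (simp add: graph_energy_def H1_energy_def)

lemma graph_Lp_eq:
  "graph_Lp G p v = (\<Sum>e\<in>edges G. LINT x:edge_dom e|lborel. \<bar>(v \<circ> edge_param e) x\<bar> powr p)"
  using finite_edges by (simp add: graph_Lp_def)

lemma zero_if_zero_on_edges:
  assumes v: "v \<in> H10_graph G" and 0: "\<And>e x. e \<in> edges G \<Longrightarrow> x \<in> edge_dom e \<Longrightarrow> v (edge_param e x) = 0"
    and q: "q \<in> graph_points G"
  shows "v q = 0"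
proof -
  have cv: "continuous_on (graph_points G) v" using v by (auto simp: H10_graph_def H1_graph_def)
  obtain e where e: "e \<in> edges G" "q \<in> edge_set e" using q by (auto simp: graph_points_eq)
  then obtain t where t: "t \<in> closure (edge_dom e)" "q = edge_param e t"
    using edge_ok[OF e(1)] by (auto simp: edge_set_eq_param closure_edge_dom)
  have "(v \<circ> edge_param e) t = 0"
    by (rule zero_on_closure[OF edge_continuous[OF cv e(1)] _ t(1)]) (use 0 e(1) in simp)
  then show ?thesis using t by simp
qed

text \<open>Strictness is what excludes a minimiser. It rests on tracing zeros: a zero at one end of
  an edge spreads over it, through \<open>P\<close>, and then to all other edges.\<close>

lemma graph_bound:
  assumes v: "v \<in> nonzero_H10 G"
  shows "graph_Lp G p v > 0" and "gns_const * graph_Lp G p v powr (2 / p) < graph_energy G v"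
proof -
  have v0: "v \<in> H10_graph G" using v by (simp add: nonzero_H10_def)
  then have cv: "continuous_on (graph_points G) v" by (auto simp: H10_graph_def H1_graph_def)
  obtain e0 x0 where nz: "e0 \<in> edges G" "x0 \<in> edge_dom e0" "(v \<circ> edge_param e0) x0 \<noteq> 0"
  proof -
    obtain q where "q \<in> graph_points G" "v q \<noteq> 0" using v by (auto simp: nonzero_H10_def)
    then have "\<not> (\<forall>e\<in>edges G. \<forall>x\<in>edge_dom e. v (edge_param e x) = 0)"
      using zero_if_zero_on_edges[OF v0] by blast
    then show ?thesis using that by auto
  qed
  note network = network_bound[where S = "edges G" and I = edge_dom and f = "\<lambda>e. v \<circ> edge_param e"
      and g = "\<lambda>e. weak_deriv (edge_dom e) (v \<circ> edge_param e)" and c = "v P",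
      OF finite_edges H10_edge(1,2)[OF v0] edge_dom_ne[OF edge_ok] disjI1[OF card_edges] nz,
      folded graph_Lp_eq graph_energy_eq]
  show "graph_Lp G p v > 0" by (rule network(1))
  have le: "gns_const * graph_Lp G p v powr (2 / p) \<le> graph_energy G v" by (rule network(2))
  have "graph_energy G v \<noteq> gns_const * graph_Lp G p v powr (2 / p)"
  proof
    assume eq: "graph_energy G v = gns_const * graph_Lp G p v powr (2 / p)"
    have growth: "((v \<circ> edge_param e) y)\<^sup>2 \<le> exp (2 * \<bar>y - x\<bar>) * ((v \<circ> edge_param e) x)\<^sup>2"
      if "e \<in> edges G" "x \<in> edge_dom e" "y \<in> edge_dom e" for e x y
      by (rule network(4)[OF _ _ _ eq that])
    have c0: "card (edges G) > 2 \<Longrightarrow> v P = 0" by (rule network(3)[OF _ _ _ eq])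
    have spread: "v (edge_param e y) = 0"
      if e: "e \<in> edges G" and z: "z \<in> closure (edge_dom e)" "v (edge_param e z) = 0" and y: "y \<in> edge_dom e" for e z y
      using zero_from_endpoint[OF edge_continuous[OF cv e] z(1) _ growth[OF e] y] z(2) by simp
    have "v P = 0"
    proof (cases "card (edges G) > 2")
      case True
      then show ?thesis using c0 by simp
    next
      case False
      \<comment> \<open>By \<open>not_line\<close> the second edge is bounded, so it has a zero at
        its outer end.\<close>
      then have "card (edges G) = 2" using card_edges by simp
      then obtain e where e: "edges G = {Unbounded P u, e}"
        using half_line unfolding card_2_iff by (metis insertE insert_commute singletonD)
      then have "\<forall>w. e \<noteq> Unbounded P w" using not_line by blast
      moreover have eG: "e \<in> edges G" using e by simp
      ultimately obtain z where z: "z \<in> closure (edge_dom e)" "v (edge_param e z) = 0"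
        using H10_edge(4)[OF v0 eG] by blast
      obtain q where q: "q \<in> closure (edge_dom e)" "edge_param e q = P" using H10_edge(3)[OF v0 eG] by blast
      have "(v \<circ> edge_param e) q = 0"
        by (rule zero_on_closure[OF edge_continuous[OF cv eG] _ q(1)]) (use spread[OF eG z] in simp)
      then show ?thesis using q by simp
    qed
    \<comment> \<open>From \<open>P\<close> the zero spreads along the edge on which
      \<open>v\<close> was supposed to be nonzero.\<close>
    then have "v (edge_param e0 x0) = 0"
      using spread[OF nz(1) _ _ nz(2)] H10_edge(3)[OF v0 nz(1)] by metis
    then show False using nz by simp
  qed
  with le show "gns_const * graph_Lp G p v powr (2 / p) < graph_energy G v" by simp
qed

text \<open>Only the half-line is used: it has room for a truncated soliton of any length away from
  \<open>P\<close>, extended by 0 to the rest of the graph.\<close>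

lemma graph_near_extremal:
  assumes "K > gns_const"
  shows "\<exists>v\<in>nonzero_H10 G. graph_energy G v < K * graph_Lp G p v powr (2 / p)"
proof -
  obtain L where L: "L > 0"
    "(LINT x:{- L..L}|lborel. \<bar>soliton x - soliton L\<bar> powr p) > 0"
    "(LINT x:{- L..L}|lborel. (tanh (rate * x) * soliton x)\<^sup>2 + (soliton x - soliton L)\<^sup>2)
       < K * (LINT x:{- L..L}|lborel. \<bar>soliton x - soliton L\<bar> powr p) powr (2 / p)"
    by (rule near_extremal[OF assms])
  define e0 where "e0 = Unbounded P u"
  have e0: "e0 \<in> edges G" using half_line by (simp add: e0_def)
  have u: "norm u = 1" using edge_ok[OF half_line] by simp
  then have uu: "u \<bullet> u = 1" by (simp add: dot_square_norm)
  \<comment> \<open>With centre L + 1 the support is [1, 2 L + 1], so the bump vanishes at parameter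
    0.\<close>
  define b where "b = bump (L + 1) L"
  have b0: "b 0 = 0" unfolding b_def by (rule bump_outside[OF L(1)]) simp
  \<comment> \<open>The inner product with the unit vector \<open>u\<close> recovers the arc-length
    parameter of a point of the half-line.\<close>
  define v where "v x = (if x \<in> edge_set e0 then b ((x - P) \<bullet> u) else 0)" for x
  have v_e0: "v (edge_param e0 t) = b t" if "t \<ge> 0" for t
    using that uu by (auto simp: v_def e0_def)
  have vP: "v P = 0" using b0 by (simp add: v_def)
  have v_other: "v x = 0" if "e \<in> edges G" "e \<noteq> e0" "x \<in> edge_set e" for e x
  proof (cases "x \<in> edge_set e0")
    case True
    have sep: "\<forall>e\<in>edges G. \<forall>e'\<in>edges G. e \<noteq> e' \<longrightarrow> edge_set e \<inter> edge_set e' \<subseteq> edge_ends e \<inter> edge_ends e'"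
      using metric unfolding metric_graph_def by (rule conjunct2)
    have "edge_set e0 \<inter> edge_set e \<subseteq> edge_ends e0 \<inter> edge_ends e"
      using that(2) by (intro bspec[OF bspec[OF sep e0] that(1), THEN mp]) simp
    then have "x \<in> edge_ends e0" using True that(3) by blast
    then show ?thesis using vP by (simp add: e0_def)
  qed (simp add: v_def)
  have v_vert: "v w = 0" if "w \<in> verts G" for w
  proof (cases "w \<in> edge_set e0")
    case True
    then have "w \<in> edge_ends e0" using metric that e0 by (auto simp: metric_graph_def)
    then show ?thesis using vP by (simp add: e0_def)
  qed (simp add: v_def)
  define R where "R = (\<Union>e\<in>edges G - {e0}. edge_set e)"
  \<comment> \<open>The half-line and the finite union of the other edges are closed, and
    \<open>v\<close> is continuous on each of them.\<close>
  have cont: "continuous_on (graph_points G) v"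
  proof -
    have "graph_points G = edge_set e0 \<union> R" using e0 by (auto simp: graph_points_eq R_def)
    moreover have "continuous_on (edge_set e0 \<union> R) v"
    proof (rule continuous_on_closed_Un)
      show "closed (edge_set e0)" by (rule closed_edge_set[OF edge_ok[OF e0]])
      show "closed R" unfolding R_def using finite_edges edge_ok by (auto intro!: closed_UN closed_edge_set)
      have "continuous_on (edge_set e0) (\<lambda>x. b ((x - P) \<bullet> u))"
        unfolding b_def by (intro continuous_on_compose2[OF continuous_bump[of UNIV]] continuous_intros) auto
      then show "continuous_on (edge_set e0) v" by (rule continuous_on_eq) (simp add: v_def)
      have R0: "v x = 0" if "x \<in> R" for x using that v_other unfolding R_def by blast
      show "continuous_on R v" by (rule continuous_on_eq[OF continuous_on_const[of R 0]]) (simp add: R0)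
    qed
    ultimately show ?thesis by simp
  qed
  have dom0: "edge_dom e0 = {0<..}" by (simp add: e0_def)
  have bump: "(v \<circ> edge_param e0) t = bump (L + 1) L t" if "t \<in> edge_dom e0" for t
    using v_e0 that dom0 by (simp add: b_def)
  have sub: "{L + 1 - L..L + 1 + L} \<subseteq> edge_dom e0"
    unfolding dom0 by (rule subsetI) simp
  note main = bump_H1[where f = "v \<circ> edge_param e0", OF edge_dom_open_interval L(1) sub bump]
  have "(v \<circ> edge_param e) t = 0" if "e \<in> edges G" "e \<noteq> e0" "t \<in> edge_dom e" for e t
    using v_other[OF that(1,2)] edge_set_eq_param[OF edge_ok[OF that(1)]] edge_dom_subset[of e] that(3) by auto
  then have other: "v \<circ> edge_param e \<in> H1_on (edge_dom e)" "H1_energy (edge_dom e) (v \<circ> edge_param e) = 0"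
    "(LINT t:edge_dom e|lborel. \<bar>v (edge_param e t)\<bar> powr p) = 0" if "e \<in> edges G" "e \<noteq> e0" for e
    using H1_zero[OF edge_dom_open_interval, of e "v \<circ> edge_param e"] that p
      set_lebesgue_integral_cong[of "edge_dom e" lborel "\<lambda>t. \<bar>v (edge_param e t)\<bar> powr p" "\<lambda>t. 0"]
    by auto
  have E: "graph_energy G v = (LINT x:{- L..L}|lborel. (tanh (rate * x) * soliton x)\<^sup>2 + (soliton x - soliton L)\<^sup>2)"
    using finite_edges e0 other(2) main(2) by (simp add: graph_energy_def sum.remove[of _ e0])
  have J: "graph_Lp G p v = (LINT x:{- L..L}|lborel. \<bar>soliton x - soliton L\<bar> powr p)"
    using finite_edges e0 other(3) main(3) by (simp add: graph_Lp_def sum.remove[of _ e0])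
  have "v \<circ> edge_param e \<in> H1_on (edge_dom e)" if "e \<in> edges G" for e
    using other(1)[OF that] main(1) by (cases "e = e0") auto
  then have "v \<in> H10_graph G"
    using cont finite_edges v_vert by (auto simp: H10_graph_def H1_graph_def outer_verts_def)
  moreover have "\<exists>x\<in>graph_points G. v x \<noteq> 0"
  proof (rule ccontr)
    assume "\<not> ?thesis"
    then have "v (edge_param e t) = 0" if "e \<in> edges G" "t \<in> edge_dom e" for e t
      using that edge_set_eq_param[OF edge_ok[OF that(1)]] edge_dom_subset[of e] by (auto simp: graph_points_eq)
    then have "(v \<circ> edge_param e0) t = 0" if "t \<in> edge_dom e0" for t using that e0 by simp
    then have "(LINT t:edge_dom e0|lborel. \<bar>(v \<circ> edge_param e0) t\<bar> powr p) = (LINT t:edge_dom e0|lborel. 0)"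
      using p by (intro set_lebesgue_integral_cong) (auto simp: dom0)
    then show False using main(3) L(2) by simp
  qed
  ultimately have "v \<in> nonzero_H10 G" by (simp add: nonzero_H10_def)
  then show ?thesis using L(3) unfolding E[symmetric] J[symmetric] by blast
qed

section \<open>The best constant and the minimization problem\<close>

lemma best_const_eq: "best_const G p = 1 / gns_const"
  unfolding best_const_def
proof (rule optimal_constants)
  fix v assume v: "v \<in> H10_graph G"
  show "gns_const * graph_Lp G p v powr (2 / p) \<le> graph_energy G v"
  proof (cases "v \<in> nonzero_H10 G")
    case True
    then show ?thesis using graph_bound(2) by (simp add: less_imp_le)
  next
    \<comment> \<open>\<open>H10_graph\<close> also contains functions vanishing on the graph, for
      which the strict bound fails and both sides are 0.\<close>
    case False
    then have "v (edge_param e t) = 0" if "e \<in> edges G" "t \<in> edge_dom e" for e t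
      using v that edge_set_eq_param[OF edge_ok[OF that(1)]] edge_dom_subset[of e]
      by (auto simp: nonzero_H10_def graph_points_eq)
    then have 0: "(v \<circ> edge_param e) t = 0" if "e \<in> edges G" "t \<in> edge_dom e" for e t
      using that by simp
    have "graph_energy G v = 0"
      using finite_edges H1_zero(2)[OF edge_dom_open_interval, of _ "v \<circ> edge_param _"] 0
      by (simp add: graph_energy_def)
    moreover have "(LINT x:edge_dom e|lborel. \<bar>(v \<circ> edge_param e) x\<bar> powr p) = 0" if "e \<in> edges G" for e
      using set_lebesgue_integral_cong[of "edge_dom e" lborel "\<lambda>x. \<bar>(v \<circ> edge_param e) x\<bar> powr p" "\<lambda>x. 0"]
        0[OF that] p by auto
    then have "graph_Lp G p v = 0" by (simp add: graph_Lp_eq)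
    ultimately show ?thesis using p by simp
  qed
next
  fix K assume "K > gns_const"
  from graph_near_extremal[OF this] show "\<exists>v\<in>H10_graph G. graph_Lp G p v > 0 \<and>
      graph_energy G v < K * graph_Lp G p v powr (2 / p)"
    using graph_bound(1) by (auto simp: nonzero_H10_def)
qed

lemma gns_quotient_gt:
  assumes "v \<in> nonzero_H10 G" shows "gns_const < gns_quotient G p v"
  using graph_bound[OF assms] by (simp add: gns_quotient_def pos_less_divide_eq)

lemma gns_quotient_lt:
  assumes "K > gns_const" shows "\<exists>v\<in>nonzero_H10 G. gns_quotient G p v < K"
proof -
  obtain v where v: "v \<in> nonzero_H10 G" "graph_energy G v < K * graph_Lp G p v powr (2 / p)"
    using graph_near_extremal[OF assms] by blast
  then show ?thesis
    using graph_bound(1)[OF v(1)] by (intro bexI[of _ v]) (simp_all add: gns_quotient_def pos_divide_less_eq)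
qed

lemma inf_gns_quotient: "(INF v\<in>nonzero_H10 G. gns_quotient G p v) = gns_const"
proof (rule antisym)
  have bdd: "bdd_below (gns_quotient G p ` nonzero_H10 G)"
    using gns_quotient_gt by (auto intro!: bdd_belowI2[of _ gns_const] less_imp_le)
  show "(INF v\<in>nonzero_H10 G. gns_quotient G p v) \<le> gns_const"
  proof (rule dense_ge)
    fix K assume "gns_const < K"
    then obtain v where "v \<in> nonzero_H10 G" "gns_quotient G p v < K" using gns_quotient_lt by blast
    then show "(INF v\<in>nonzero_H10 G. gns_quotient G p v) \<le> K"
      using cINF_lower[OF bdd] by (meson less_imp_le order_trans)
  qed
  show "gns_const \<le> (INF v\<in>nonzero_H10 G. gns_quotient G p v)"
    using gns_quotient_lt[of "gns_const + 1"] gns_quotient_gt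
    by (intro cINF_greatest) (auto intro: less_imp_le)
qed

text \<open>Every quotient lies strictly above \<open>gns_const\<close>, so a near optimal function
  has a smaller one.\<close>

lemma gns_not_attained: "\<not> is_arg_min (gns_quotient G p) (\<lambda>v. v \<in> nonzero_H10 G) v"
proof
  assume min: "is_arg_min (gns_quotient G p) (\<lambda>v. v \<in> nonzero_H10 G) v"
  then have "v \<in> nonzero_H10 G" by (simp add: is_arg_min_def)
  then obtain w where "w \<in> nonzero_H10 G" "gns_quotient G p w < gns_quotient G p v"
    using gns_quotient_lt[OF gns_quotient_gt] by blast
  then show False using min by (auto simp: is_arg_min_def)
qed

end

theorem theorem11:
  fixes p :: real and G :: graph and P u :: plane
  assumes "p > 2"
    and "metric_graph G"
    and "finite (edges G)"
    and "Unbounded P u \<in> edges G"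
    and "\<forall>e\<in>edges G. P \<in> edge_ends e"
    and "inner_verts G = {P}"
    and not_line: "\<not> (\<exists>w. edges G = {Unbounded P u, Unbounded P w})"
  shows "1 / best_const G p = (INF v\<in>nonzero_H10 G. gns_quotient G p v) \<and>
         \<not> (\<exists>v. is_arg_min (gns_quotient G p) (\<lambda>v. v \<in> nonzero_H10 G) v) \<and>
         best_const G p = best_const_line p"
proof -
  interpret star_graph p G P u
    using assms by unfold_locales auto
  show ?thesis
    using best_const_eq best_const_line_eq inf_gns_quotient gns_not_attained by simp
qed

end
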